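(* Let $r\ge 4$, $k\ge 2$ be integers, let $p\ge 1$ be a real number, and let $n>(r-1)k$ be an integer. If $G$ is a $k$-chromatic $r$-graph of order $n$, then \[ \lambda^{(p)}(G)\le \lambda^{(p)}(Q_k^r(n)), \] with equality if and only if $G$ is isomorphic to $Q_k^r(n)$.
   Context: An $r$-graph is a pair $G=(V,E)$ with $V$ a finite set and $E$ a family of $r$-element subsets of $V$; its order is $|V|$. For $x=(x_v)_{v\in V}\in\mathbb R^V$ put $P_G(x)=r!\sum_{e\in E}\prod_{v\in e}x_v$. For real $p\ge1$ the $p$-spectral radius of $G$ is $\lambda^{(p)}(G)=\max\{P_G(x): \sum_{v\in V}|x_v|^p=1\}$. An $r$-graph is called $k$-chromatic if its vertex set can be partitioned into $k$ (possibly empty) classes so that no edge is contained in a single class. For nonnegative integers $n_1,\dots,n_k$ with $n_1+\cdots+n_k=n$, $Q(n_1,\dots,n_k)$ is the $r$-graph on a vertex set partitioned into classes $V_1,\dots,V_k$ with $|V_i|=n_i$, whose edges are precisely all $r$-subsets of the vertex set not contained in a single class. $Q_k^r(n)$ denotes the $r$-graph $Q(n_1,\dots,n_k)$ with $n_1+\dots+n_k=n$ whose class sizes pairwise differ by at most one. *)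

theory Defs
  imports "HOL-Analysis.Analysis" "HOL-Library.Disjoint_Sets"
begin

type_synonym 'a hypergraph = "'a set \<times> 'a set set"

abbreviation verts :: "'a hypergraph \<Rightarrow> 'a set" where
  "verts G \<equiv> fst G"

abbreviation edges :: "'a hypergraph \<Rightarrow> 'a set set" where
  "edges G \<equiv> snd G"

definition r_graph :: "nat \<Rightarrow> 'a hypergraph \<Rightarrow> bool" where
  "r_graph r G \<longleftrightarrow> finite (verts G) \<and> (\<forall>e\<in>edges G. e \<subseteq> verts G \<and> card e = r)"

definition isomorphic :: "'a hypergraph \<Rightarrow> 'b hypergraph \<Rightarrow> bool" where
  "isomorphic G H \<longleftrightarrow>
     (\<exists>f. bij_betw f (verts G) (verts H) \<and> edges H = (\<lambda>e. f ` e) ` edges G)"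

definition poly_form :: "nat \<Rightarrow> 'a hypergraph \<Rightarrow> ('a \<Rightarrow> real) \<Rightarrow> real" where
  "poly_form r G x = fact r * (\<Sum>e\<in>edges G. \<Prod>v\<in>e. x v)"

text \<open>Weight vectors are total functions; only their values on the vertices matter.
  The maximum is attained as soon as there is a vertex, see \<open>p_spectral_radius_attained\<close>.\<close>

definition p_spectral_radius :: "nat \<Rightarrow> real \<Rightarrow> 'a hypergraph \<Rightarrow> real" where
  "p_spectral_radius r p G =
     (GREATEST m. m \<in> {poly_form r G x | x. (\<Sum>v\<in>verts G. \<bar>x v\<bar> powr p) = 1})"

definition k_chromatic :: "nat \<Rightarrow> 'a hypergraph \<Rightarrow> bool" where
  "k_chromatic k G \<longleftrightarrow>
     (\<exists>W :: nat \<Rightarrow> 'a set. (\<Union>i<k. W i) = verts G \<and> disjoint_family_on W {..<k} \<and>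
        (\<forall>e\<in>edges G. \<forall>i<k. \<not> e \<subseteq> W i))"

text \<open>\<open>Q r k ns\<close> is the graph \<open>Q(ns 0, \<dots>, ns (k - 1))\<close>; a vertex is a pair of
  the index of its class and its position in that class.\<close>

definition Q_class :: "(nat \<Rightarrow> nat) \<Rightarrow> nat \<Rightarrow> (nat \<times> nat) set" where
  "Q_class ns i = {i} \<times> {..<ns i}"

definition Q :: "nat \<Rightarrow> nat \<Rightarrow> (nat \<Rightarrow> nat) \<Rightarrow> (nat \<times> nat) hypergraph" where
  "Q r k ns =
     (let V = (\<Union>i<k. Q_class ns i)
      in (V, {e. e \<subseteq> V \<and> card e = r \<and> (\<forall>i<k. \<not> e \<subseteq> Q_class ns i)}))"

text \<open>The graphs \<open>Q r k ns\<close> with \<open>balanced_sizes k n ns\<close> are exactly the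
  representatives of the graph that is unique up to isomorphism and written \<open>Q_k^r(n)\<close>;
  they differ only in the order of the classes.\<close>

definition balanced_sizes :: "nat \<Rightarrow> nat \<Rightarrow> (nat \<Rightarrow> nat) \<Rightarrow> bool" where
  "balanced_sizes k n ns \<longleftrightarrow> (\<Sum>i<k. ns i) = n \<and> (\<forall>i<k. \<forall>j<k. ns i \<le> ns j + 1)"

lemma balanced_sizes_exists:
  assumes "k > 0"
  shows "balanced_sizes k n (\<lambda>i. n div k + (if i < n mod k then 1 else 0))"
proof -
  have "{i. i < k \<and> i < n mod k} = {..<n mod k}"
    using mod_less_divisor[OF assms, of n] by auto
  then have "(\<Sum>i<k. if i < n mod k then 1 else 0 :: nat) = n mod k"
    by (simp add: sum.If_cases Int_def)
  then show ?thesis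
    by (auto simp: balanced_sizes_def sum.distrib)
qed

lemma p_spectral_radius_attained:
  fixes G :: "'a hypergraph"
  assumes G: "r_graph r G" and ne: "verts G \<noteq> {}" and p: "p \<ge> 1"
  shows "\<exists>x. (\<Sum>v\<in>verts G. \<bar>x v\<bar> powr p) = 1 \<and> poly_form r G x = p_spectral_radius r p G"
    and "\<And>y. (\<Sum>v\<in>verts G. \<bar>y v\<bar> powr p) = 1 \<Longrightarrow> poly_form r G y \<le> p_spectral_radius r p G"
proof -
  let ?V = "verts G"
  let ?N = "\<lambda>x :: 'a \<Rightarrow> real. \<Sum>v\<in>?V. \<bar>x v\<bar> powr p"
  define B :: "('a \<Rightarrow> real) set"
    where "B = PiE UNIV (\<lambda>v. if v \<in> ?V then {-1..1} else {0})"
  define S where "S = B \<inter> {x. ?N x = 1}"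
  have fin: "finite ?V" using G by (simp add: r_graph_def)
  have "compactin (product_topology (\<lambda>i. euclidean) UNIV) B"
    unfolding B_def by (subst compactin_PiE) auto
  then have "compact B"
    by (simp add: euclidean_product_topology)
  moreover have "closed {x. ?N x = 1}"
  proof -
    have "continuous_on UNIV (\<lambda>x :: 'a \<Rightarrow> real. \<bar>x v\<bar> powr p)" for v
    proof (rule continuous_on_powr')
      show "continuous_on UNIV (\<lambda>x :: 'a \<Rightarrow> real. \<bar>x v\<bar>)"
        by (rule continuous_on_rabs) (rule continuous_on_product_coordinates)
    qed (use p in auto)
    then have "continuous_on UNIV ?N"
      by (rule continuous_on_sum)
    then show ?thesis
      by (rule closed_Collect_eq) (rule continuous_on_const)
  qed
  ultimately have "compact S" unfolding S_def by (rule compact_Int_closed)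
  obtain v0 where v0: "v0 \<in> ?V" using ne by blast
  have "?N (\<lambda>v. if v = v0 then 1 else 0) = (\<Sum>v\<in>?V. if v = v0 then 1 else 0)"
    using p by (intro sum.cong) auto
  also have "\<dots> = 1" using fin v0 by simp
  finally have "(\<lambda>v. if v = v0 then 1 else 0) \<in> S"
    using v0 unfolding S_def B_def by (auto simp: PiE_def Pi_def)
  then have "S \<noteq> {}" by blast
  moreover have "continuous_on S (poly_form r G)"
  proof -
    have "continuous_on S (\<lambda>x. x v)" for v
      by (rule continuous_on_subset [OF continuous_on_product_coordinates]) simp
    then have "continuous_on S (\<lambda>x. \<Prod>v\<in>e. x v)" for e
      by (rule continuous_on_prod)
    then have "continuous_on S (\<lambda>x. \<Sum>e\<in>edges G. \<Prod>v\<in>e. x v)"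
      by (rule continuous_on_sum)
    then show ?thesis
      unfolding poly_form_def [abs_def] by (rule continuous_on_mult_left)
  qed
  ultimately obtain x where x: "x \<in> S" "\<And>y. y \<in> S \<Longrightarrow> poly_form r G y \<le> poly_form r G x"
    using continuous_attains_sup[OF \<open>compact S\<close>] by blast
  have max: "poly_form r G y \<le> poly_form r G x" if y: "?N y = 1" for y
  proof -
    define z where "z = (\<lambda>v. if v \<in> ?V then y v else 0)"
    have "?N z = 1" using y by (simp add: z_def)
    moreover have "\<bar>y v\<bar> \<le> 1" if "v \<in> ?V" for v
    proof (rule ccontr)
      assume "\<not> \<bar>y v\<bar> \<le> 1"
      then have "1 < \<bar>y v\<bar> powr p" using p by (intro gr_one_powr) auto
      also have "\<dots> \<le> ?N y" using fin that by (intro member_le_sum) auto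
      finally show False using y by simp
    qed
    ultimately have "z \<in> S"
      unfolding S_def B_def by (auto simp: z_def PiE_def Pi_def abs_le_iff minus_le_iff)
    moreover have "poly_form r G z = poly_form r G y"
    proof -
      have "(\<Prod>v\<in>e. z v) = (\<Prod>v\<in>e. y v)" if "e \<in> edges G" for e
        using that G by (intro prod.cong) (auto simp: z_def r_graph_def)
      then show ?thesis by (simp add: poly_form_def)
    qed
    ultimately show ?thesis using x(2) by metis
  qed
  have "p_spectral_radius r p G = poly_form r G x"
    unfolding p_spectral_radius_def
    by (rule Greatest_equality) (use x(1) max in \<open>auto simp: S_def\<close>)
  then show "\<exists>x. ?N x = 1 \<and> poly_form r G x = p_spectral_radius r p G"
    and "\<And>y. ?N y = 1 \<Longrightarrow> poly_form r G y \<le> p_spectral_radius r p G"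
    using x(1) max by (auto simp: S_def)
qed

end

theory Submission
  imports Defs "HOL-Computational_Algebra.Polynomial"
begin

text \<open>
  In an optimal nonnegative vector of a complete \<open>k\<close>-chromatic graph all weights are positive and
  constant on classes, because averaging two unequal weights would increase the form. So the
  problem is about class sizes and one weight per class. If two sizes satisfy \<open>a + 1 \<ge> b + 2\<close> with
  weights \<open>x\<close> and \<open>y\<close>, moving one vertex from the larger to the smaller class increases the form
  strictly. When \<open>a x \<ge> b y\<close>, move the vertex with its weight and average the smaller class;
  Bernoulli's inequality shows that averaging does not lose. Otherwise redistribute
  so that both class sums are kept. The quotient of the new and the old form decreases in the
  quotient \<open>z\<close> of the class sums, so only \<open>z = (a + 1) / a\<close> matters, that is \<open>a x = b y\<close>,
  where the first case applies and is improved by interchanging the class sums.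
  All comparisons hold for every elementary symmetric polynomial of the two classes
  and for the \<open>p\<close>-norm at once, so the remaining classes play no role.
  Finally, positivity of the optimal vector makes every missing edge cost something.
\<close>

section \<open>Two classes of equal weights\<close>

lemma sum_reflect:
  fixes f :: "nat \<Rightarrow> 'b::comm_monoid_add"
  assumes "lo \<le> j"
  shows "(\<Sum>i=lo..j-lo. f i) = (\<Sum>i=lo..j-lo. f (j - i))"
proof -
  have "(\<Sum>i=lo..j-lo. f i) = (\<Sum>i=lo..j-lo. f (j - lo + lo - i))"
    by (subst sum.atLeastAtMost_rev) (simp add: add.commute)
  also have "j - lo + lo = j" using assms by simp
  finally show ?thesis .
qed

text \<open>The coefficient of \<open>X ^ i\<close> in the \<open>i\<close>-th elementary symmetric polynomial
  of \<open>n\<close> equal numbers with sum \<open>X\<close>.\<close>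

definition alpha :: "nat \<Rightarrow> nat \<Rightarrow> real" where
  "alpha n i = real (n choose i) / real n ^ i"

lemma alpha_nonneg: "alpha n i \<ge> 0"
  by (simp add: alpha_def)

lemma alpha_pos: "i \<le> n \<Longrightarrow> 0 < n \<Longrightarrow> alpha n i > 0"
  by (simp add: alpha_def)

lemma alpha_eq_0: "n < i \<Longrightarrow> alpha n i = 0"
  by (simp add: alpha_def)

text \<open>By the absorption identities for binomial coefficients. The factor
  \<open>1 - i / n\<close> grows with \<open>n\<close>, which drives the comparisons of
  \<open>alpha\<close> for different sizes.\<close>

lemma alpha_Suc:
  assumes "n > 0"
  shows "alpha n (Suc i) = alpha n i * ((1 - real i / real n) / real (Suc i))"
proof -
  have "real (Suc i) * real (n choose Suc i) = (real n - real i) * real (n choose i)"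
    using gbinomial_absorption[of i "real n"] gbinomial_absorb_comp[of "real n" i]
    by (simp add: binomial_gbinomial)
  then have "real (n choose Suc i) = (real n - real i) * real (n choose i) / real (Suc i)"
    by (simp add: field_simps del: of_nat_Suc)
  then show ?thesis
    using assms by (simp add: alpha_def divide_simps del: of_nat_Suc)
qed

text \<open>By \<open>alpha_Suc\<close>, for \<open>i < m\<close> a step in \<open>i\<close>
  multiplies the quotient of \<open>alpha n i\<close> and \<open>alpha m i\<close> by
  \<open>(1 - i / n) / (1 - i / m) >= 1\<close>. The form without division covers
  \<open>i > m\<close>, where \<open>alpha m i\<close> vanishes.\<close>

lemma alpha_ratio_mono:
  assumes "0 < m" "m \<le> n" "l \<le> i"
  shows "alpha m i * alpha n l \<le> alpha n i * alpha m l"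
  using assms(3)
proof (induction i rule: dec_induct)
  case (step i)
  show ?case
  proof (cases "i \<le> m")
    case True
    have "alpha m i * alpha n l * ((1 - real i / real m) / real (Suc i))
        \<le> alpha n i * alpha m l * ((1 - real i / real n) / real (Suc i))"
    proof (rule mult_mono[OF step.IH])
      show "(1 - real i / real m) / real (Suc i) \<le> (1 - real i / real n) / real (Suc i)"
        using assms by (intro divide_right_mono diff_left_mono divide_left_mono) auto
      show "0 \<le> (1 - real i / real m) / real (Suc i)"
        using True assms by (simp add: divide_simps)
    qed (simp add: alpha_nonneg)
    then show ?thesis
      using assms by (simp add: alpha_Suc mult_ac del: of_nat_Suc)
  next
    case False
    then show ?thesis by (simp add: alpha_eq_0 alpha_nonneg)
  qed
qed simp

text \<open>For \<open>i = 2\<close> this compares \<open>(1 - 1 / m) / 2\<close> with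
  \<open>(1 - 1 / n) / 2\<close>; \<open>alpha_ratio_mono\<close> carries it to larger
  \<open>i\<close>. The case \<open>m = 1\<close> is separate because \<open>alpha 1 2 = 0\<close>
  cannot be cancelled.\<close>

lemma alpha_less:
  assumes "m < n" "0 < m" "2 \<le> i" "i \<le> n"
  shows "alpha m i < alpha n i"
proof -
  have 2: "alpha m 2 < alpha n 2"
  proof -
    have eq: "alpha k 2 = (1 - 1 / real k) / 2" if "k > 0" for k
      using that alpha_Suc[of k 1] alpha_Suc[of k 0] by (simp add: alpha_def numeral_2_eq_2)
    moreover have "1 / real n < 1 / real m" using assms by (intro divide_strict_left_mono) auto
    moreover have "alpha m 2 = (1 - 1 / real m) / 2" "alpha n 2 = (1 - 1 / real n) / 2"
      by (rule eq; use assms in simp)+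
    ultimately show ?thesis by simp
  qed
  show ?thesis
  proof (cases "m = 1")
    case True
    then show ?thesis using assms by (simp add: alpha_eq_0 alpha_pos)
  next
    case False
    then have m2: "alpha m 2 > 0" using assms by (intro alpha_pos) auto
    have "alpha m i * alpha n 2 \<le> alpha n i * alpha m 2"
      using assms by (intro alpha_ratio_mono) auto
    also have "\<dots> < alpha n i * alpha n 2"
      using 2 assms by (intro mult_strict_left_mono alpha_pos) auto
    finally show ?thesis using 2 m2 by (simp add: mult_less_cancel_right)
  qed
qed

text \<open>For \<open>lo = 0\<close> this is the \<open>j\<close>-th elementary symmetric polynomial of \<open>a\<close> numbers \<open>x\<close>
  and \<open>b\<close> numbers \<open>y\<close>; for \<open>lo = 1\<close> the terms that lie in a single class are left out.\<close>

definition pair_sum :: "nat \<Rightarrow> nat \<Rightarrow> nat \<Rightarrow> real \<Rightarrow> nat \<Rightarrow> real \<Rightarrow> real" where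
  "pair_sum lo j a x b y =
     (\<Sum>i=lo..j-lo. real (a choose i) * x ^ i * (real (b choose (j - i)) * y ^ (j - i)))"

lemma pair_sum_alpha:
  assumes "a > 0" "b > 0"
  shows "pair_sum lo j a (X / real a) b (Y / real b)
    = (\<Sum>i=lo..j-lo. alpha a i * alpha b (j - i) * (X ^ i * Y ^ (j - i)))"
  unfolding pair_sum_def alpha_def by (simp add: power_divide mult_ac)

text \<open>The left side is the elementary symmetric polynomial of degree \<open>j + 1\<close> of
  \<open>b\<close> numbers \<open>y\<close> and one \<open>x\<close>. With the mean written as
  \<open>y * (1 + d)\<close> it is the first-order part of the right side in \<open>d\<close>, so
  Bernoulli's inequality applies.\<close>

lemma merge_coeff_le:
  fixes x y :: real
  assumes "0 \<le> x" "0 < y"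
  shows "real (b choose Suc j) * y ^ Suc j + x * (real (b choose j) * y ^ j)
    \<le> real (Suc b choose Suc j) * ((real b * y + x) / real (Suc b)) ^ Suc j"
proof -
  define d where "d = (x - y) / (real (Suc b) * y)"
  have "1 + d = (x + real b * y) / (real (Suc b) * y)"
    using assms by (simp add: d_def divide_simps) (simp add: algebra_simps)
  also have "\<dots> \<ge> 0" using assms by (intro divide_nonneg_nonneg) auto
  finally have "- 1 \<le> d" by simp
  have C: "real (b choose j) * real (Suc b) = real (Suc b choose Suc j) * real (Suc j)"
    using Suc_times_binomial_eq[of b j] by (metis of_nat_mult mult.commute)
  have "real (b choose Suc j) * y ^ Suc j + x * (real (b choose j) * y ^ j)
    = y ^ j * (real (Suc b choose Suc j) * y + real (b choose j) * (x - y))"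
    by (simp add: algebra_simps)
  also have "real (b choose j) * (x - y) = real (b choose j) * real (Suc b) * y * d"
    using assms by (simp add: d_def del: of_nat_Suc)
  also have "\<dots> = real (Suc b choose Suc j) * real (Suc j) * y * d"
    by (simp only: C)
  also have "y ^ j * (real (Suc b choose Suc j) * y + \<dots>)
    = real (Suc b choose Suc j) * y ^ Suc j * (1 + real (Suc j) * d)"
    by (simp add: algebra_simps)
  also have "\<dots> \<le> real (Suc b choose Suc j) * y ^ Suc j * (1 + d) ^ Suc j"
    using assms \<open>- 1 \<le> d\<close> by (intro mult_left_mono Bernoulli_inequality) auto
  also have "y ^ Suc j * (1 + d) ^ Suc j = (y * (1 + d)) ^ Suc j"
    by (simp only: power_mult_distrib)
  then have "real (Suc b choose Suc j) * y ^ Suc j * (1 + d) ^ Suc j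
     = real (Suc b choose Suc j) * (y * (1 + d)) ^ Suc j" by (simp only: mult.assoc)
  also have "y * (1 + d) = (real b * y + x) / real (Suc b)"
    using assms by (simp add: d_def divide_simps) (simp add: algebra_simps)
  finally show ?thesis .
qed

section \<open>Generating polynomials and the move of one vertex\<close>

lemma coeff_const_power:
  fixes x :: "'b :: comm_ring_1"
  shows "coeff ([:1, x:] ^ n) i = of_nat (n choose i) * x ^ i"
proof (cases "i \<le> n")
  case False
  have "degree ([:1, x:] ^ n) \<le> 1 * n"
    by (rule order.trans[OF degree_power_le]) (simp add: mult_right_mono)
  with False show ?thesis by (simp add: coeff_eq_0 binomial_eq_0)
qed (simp add: coeff_linear_poly_power)

text \<open>As coefficients of a product of linear factors, these sums turn the move of one vertex
  into a regrouping of factors.\<close>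

lemma pair_sum_coeff:
  "pair_sum 0 j a x b y = coeff ([:1, x:] ^ a * [:1, y:] ^ b) j"
  unfolding pair_sum_def by (simp add: coeff_mult coeff_const_power atMost_atLeast0)

lemma pair_sum_1:
  assumes "0 < r"
  shows "pair_sum 1 r a x b y =
    pair_sum 0 r a x b y - real (a choose r) * x ^ r - real (b choose r) * y ^ r"
proof -
  have "{0..r} = insert 0 (insert r {1..r-1})" using assms by auto
  then show ?thesis using assms unfolding pair_sum_def by simp
qed

text \<open>Moving one number \<open>x\<close> to the other class and then averaging that class.\<close>

lemma pair_sum_merge:
  fixes x y :: real and a b j r :: nat
  assumes "0 \<le> x" "0 < y"
  defines "y' \<equiv> (real b * y + x) / real (Suc b)"
  shows "pair_sum 0 j (Suc a) x b y \<le> pair_sum 0 j a x (Suc b) y'"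
    and "0 < r \<Longrightarrow> pair_sum 1 r (Suc a) x b y
      + x * (real (a choose (r - 1)) * x ^ (r - 1) - real (b choose (r - 1)) * y ^ (r - 1))
      \<le> pair_sum 1 r a x (Suc b) y'"
proof -
  \<comment> \<open>\<open>g\<close> belongs to the smaller class after it has received
    \<open>x\<close> but before averaging.\<close>
  define g where "g i = coeff ([:1, x:] * [:1, y:] ^ b) i" for i
  have g0: "g 0 = 1" by (simp add: g_def coeff_const_power)
  have gS: "g (Suc i) = real (b choose Suc i) * y ^ Suc i + x * (real (b choose i) * y ^ i)" for i
    by (simp add: g_def coeff_const_power coeff_pCons)
  have gle: "g i \<le> real (Suc b choose i) * y' ^ i" for i
    using merge_coeff_le[OF assms(1,2), of b] by (cases i) (simp_all only: g0 gS y'_def, simp)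
  have sum_le: "(\<Sum>i=lo..j-lo. real (a choose i) * x ^ i * g (j - i)) \<le> pair_sum lo j a x (Suc b) y'"
    for lo j unfolding pair_sum_def using assms(1) by (intro sum_mono mult_left_mono gle) auto
  have eq: "pair_sum 0 j (Suc a) x b y = (\<Sum>i=0..j. real (a choose i) * x ^ i * g (j - i))" for j
  proof -
    have "[:1, x:] ^ Suc a * [:1, y:] ^ b = [:1, x:] ^ a * ([:1, x:] * [:1, y:] ^ b)"
      by (simp only: power_Suc mult_ac)
    then have "pair_sum 0 j (Suc a) x b y = coeff ([:1, x:] ^ a * ([:1, x:] * [:1, y:] ^ b)) j"
      by (simp only: pair_sum_coeff)
    also have "\<dots> = (\<Sum>i=0..j. real (a choose i) * x ^ i * g (j - i))"
      unfolding coeff_mult[of "[:1, x:] ^ a"] g_def by (simp only: coeff_const_power atMost_atLeast0)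
    finally show ?thesis .
  qed
  show "pair_sum 0 j (Suc a) x b y \<le> pair_sum 0 j a x (Suc b) y'"
    unfolding eq using sum_le[where lo = 0 and j = j] by simp
  assume r: "0 < r"
  then obtain s where s: "r = Suc s" by (cases r) auto
  have "{0..r} = insert 0 (insert r {1..r-1})" using r by auto
  then have "(\<Sum>i=0..r. real (a choose i) * x ^ i * g (r - i))
     = g r + real (a choose r) * x ^ r + (\<Sum>i=1..r-1. real (a choose i) * x ^ i * g (r - i))"
    using r by (simp add: g0)
  then have "pair_sum 1 r (Suc a) x b y = g r + real (a choose r) * x ^ r
     - real (Suc a choose r) * x ^ r - real (b choose r) * y ^ r
     + (\<Sum>i=1..r-1. real (a choose i) * x ^ i * g (r - i))"
    unfolding pair_sum_1[OF r] eq by simp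
  \<comment> \<open>The \<open>r\<close>-sets joining the moved vertex to \<open>r - 1\<close> old
    classmates become crossing, those joining it to \<open>r - 1\<close> members of its new class
    cease to be; this is the extra term.\<close>
  also have "g r + real (a choose r) * x ^ r
     - real (Suc a choose r) * x ^ r - real (b choose r) * y ^ r
     = - x * (real (a choose (r - 1)) * x ^ (r - 1) - real (b choose (r - 1)) * y ^ (r - 1))"
    by (simp add: s gS algebra_simps)
  finally show "pair_sum 1 r (Suc a) x b y
      + x * (real (a choose (r - 1)) * x ^ (r - 1) - real (b choose (r - 1)) * y ^ (r - 1))
      \<le> pair_sum 1 r a x (Suc b) y'"
    using sum_le[where lo = 1 and j = r] by simp
qed

text \<open>Terms with indices \<open>i <= l\<close> and \<open>i + l = j\<close> are paired.
  Together they factor into a difference of \<open>alpha\<close> products, nonnegative by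
  \<open>alpha_ratio_mono\<close>, and \<open>X ^ l * Y ^ i - Y ^ l * X ^ i\<close>, nonnegative
  because \<open>Y <= X\<close>.\<close>

lemma pair_sum_swap:
  fixes X Y :: real
  assumes "0 \<le> Y" "Y \<le> X" "0 < b" "b \<le> a" "lo \<le> j"
  shows "pair_sum lo j a (Y / real a) b (X / real b) \<le> pair_sum lo j a (X / real a) b (Y / real b)"
proof -
  define D where "D i = alpha a i * alpha b (j - i) * (X ^ i * Y ^ (j - i) - Y ^ i * X ^ (j - i))" for i
  have "2 * (\<Sum>i=lo..j-lo. D i) = (\<Sum>i=lo..j-lo. D i) + (\<Sum>i=lo..j-lo. D (j - i))"
    using sum_reflect[OF assms(5), of D] by simp
  also have "\<dots> = (\<Sum>i=lo..j-lo. D i + D (j - i))" by (simp add: sum.distrib)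
  also have "\<dots> \<ge> 0"
  proof (rule sum_nonneg)
    fix i assume i: "i \<in> {lo..j-lo}"
    have key: "0 \<le> D i + D l" if "i + l = j" "i \<le> l" for i l
    proof -
      have jl: "j - i = l" "j - l = i" using that by auto
      have "D i + D l = (alpha a l * alpha b i - alpha b l * alpha a i) * (X ^ l * Y ^ i - Y ^ l * X ^ i)"
        unfolding D_def jl by (simp add: algebra_simps)
      also have "\<dots> \<ge> 0"
      proof (rule mult_nonneg_nonneg)
        show "0 \<le> alpha a l * alpha b i - alpha b l * alpha a i"
          using alpha_ratio_mono[of b a i l] assms that by simp
        have "X ^ l * Y ^ i - Y ^ l * X ^ i = (X * Y) ^ i * (X ^ (l - i) - Y ^ (l - i))"
          using that by (auto simp: le_iff_add power_add algebra_simps)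
        also have "\<dots> \<ge> 0" using assms by (simp add: power_mono)
        finally show "0 \<le> X ^ l * Y ^ i - Y ^ l * X ^ i" .
      qed
      finally show ?thesis .
    qed
    have "i + (j - i) = j" using i by auto
    then show "0 \<le> D i + D (j - i)"
      using key[of i "j - i"] key[of "j - i" i] by (cases "i \<le> j - i") (auto simp: add.commute)
  qed
  finally have "0 \<le> (\<Sum>i=lo..j-lo. D i)" by simp
  also have "\<dots> = pair_sum lo j a (X / real a) b (Y / real b) - pair_sum lo j a (Y / real a) b (X / real b)"
    using assms by (simp add: pair_sum_alpha D_def right_diff_distrib sum_subtractf)
  finally show ?thesis by simp
qed

text \<open>A Chebyshev-type argument: symmetrizing the double sum over \<open>i\<close> and
  \<open>l\<close> leaves products of two differences of equal sign, one of coefficients and one of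
  powers. It serves to show that a quotient of polynomials decreases when the coefficient quotients
  \<open>f i / g i\<close> do.\<close>

lemma ratio_antimono:
  fixes f g :: "nat \<Rightarrow> real" and z w :: real
  assumes fg: "\<And>i l. i \<in> I \<Longrightarrow> l \<in> I \<Longrightarrow> i \<le> l \<Longrightarrow> f l * g i \<le> f i * g l"
    and z: "0 \<le> z" "z \<le> w"
  shows "(\<Sum>i\<in>I. f i * w ^ i) * (\<Sum>i\<in>I. g i * z ^ i) \<le> (\<Sum>i\<in>I. f i * z ^ i) * (\<Sum>i\<in>I. g i * w ^ i)"
proof -
  define T where "T i l = f i * g l * (z ^ i * w ^ l - w ^ i * z ^ l)" for i l
  have *: "0 \<le> T i l + T l i" if "i \<in> I" "l \<in> I" "i \<le> l" for i l
  proof -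
    have "T i l + T l i = (f i * g l - f l * g i) * (z ^ i * w ^ l - w ^ i * z ^ l)"
      by (simp add: T_def algebra_simps)
    also have "z ^ i * w ^ l - w ^ i * z ^ l = (z * w) ^ i * (w ^ (l - i) - z ^ (l - i))"
      using that by (simp add: right_diff_distrib power_mult_distrib mult_ac
              flip: power_add)
    also have "0 \<le> (f i * g l - f l * g i) * ((z * w) ^ i * (w ^ (l - i) - z ^ (l - i)))"
      using fg[OF that] z by (intro mult_nonneg_nonneg) (auto simp: power_mono)
    finally show ?thesis .
  qed
  have "2 * (\<Sum>i\<in>I. \<Sum>l\<in>I. T i l) = (\<Sum>i\<in>I. \<Sum>l\<in>I. T i l) + (\<Sum>i\<in>I. \<Sum>l\<in>I. T l i)"
    by (subst (3) sum.swap) simp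
  also have "\<dots> = (\<Sum>i\<in>I. \<Sum>l\<in>I. T i l + T l i)" by (simp add: sum.distrib)
  also have "\<dots> \<ge> 0"
  proof (intro sum_nonneg)
    fix i l assume "i \<in> I" "l \<in> I"
    then show "0 \<le> T i l + T l i" using *[of i l] *[of l i] by (cases "i \<le> l") auto
  qed
  finally have "0 \<le> (\<Sum>i\<in>I. \<Sum>l\<in>I. T i l)" by simp
  also have "\<dots> = (\<Sum>i\<in>I. f i * z ^ i) * (\<Sum>i\<in>I. g i * w ^ i)
      - (\<Sum>i\<in>I. f i * w ^ i) * (\<Sum>i\<in>I. g i * z ^ i)"
    unfolding sum_product by (simp add: T_def algebra_simps sum_subtractf)
  finally show ?thesis by simp
qed

text \<open>Keep both class sums \<open>X\<close> and \<open>Y\<close>. After division by \<open>Y ^ j\<close> both sides become polynomials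
  in \<open>z = X / Y\<close> whose quotient decreases in \<open>z\<close>, so it suffices to treat \<open>z = (a + 1) / a\<close>;
  there moving a vertex without changing the weights does not lose, and averaging and
  swapping class sums leads to the right hand side.\<close>

lemma pair_sum_keep:
  fixes x y :: real and a b j r :: nat
  assumes "0 < x" "0 < y" "0 < b" "b < a" "real a * x \<le> real b * y"
  defines "x' \<equiv> real (Suc a) * x / real a" and "y' \<equiv> real b * y / real (Suc b)"
  shows "pair_sum 0 j (Suc a) x b y \<le> pair_sum 0 j a x' (Suc b) y'"
    and "3 \<le> r \<Longrightarrow> r \<le> Suc a \<Longrightarrow> pair_sum 1 r (Suc a) x b y < pair_sum 1 r a x' (Suc b) y'"
proof -
  define f where "f j i = alpha a i * alpha (Suc b) (j - i)" for j i
  define g where "g j i = alpha (Suc a) i * alpha b (j - i)" for j i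
  define F where "F lo j z = (\<Sum>i=lo..j-lo. f j i * z ^ i)" for lo j and z :: real
  define G where "G lo j z = (\<Sum>i=lo..j-lo. g j i * z ^ i)" for lo j and z :: real
  \<comment> \<open>The hypothesis \<open>a * x <= b * y\<close> says exactly that the quotient
    \<open>z\<close> of the class sums is at most \<open>w\<close>.\<close>
  define z where "z = real (Suc a) * x / (real b * y)"
  define w where "w = real (Suc a) / real a"
  have a: "0 < a" using assms by simp
  have z: "0 < z" "z \<le> w"
    using assms by (auto simp: z_def w_def divide_simps mult_ac simp del: of_nat_Suc)
  have pow: "X ^ i * Y ^ (j - i) = Y ^ j * (X / Y) ^ i" if "i \<le> j" "0 < Y" for i j and X Y :: real
    using that by (simp add: power_divide power_diff)
  have F: "pair_sum lo j a (X / real a) (Suc b) (Y / real (Suc b)) = Y ^ j * F lo j (X / Y)"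
    if "0 < Y" for lo j X Y
    using that a unfolding pair_sum_alpha[OF a zero_less_Suc] F_def sum_distrib_left
    by (intro sum.cong refl) (subst pow, auto simp: f_def)
  have G: "pair_sum lo j (Suc a) (X / real (Suc a)) b (Y / real b) = Y ^ j * G lo j (X / Y)"
    if "0 < Y" for lo j X Y
    using that unfolding pair_sum_alpha[OF zero_less_Suc assms(3)] G_def sum_distrib_left
    by (intro sum.cong refl) (subst pow, auto simp: g_def)
  have old: "pair_sum lo j (Suc a) x b y = (real b * y) ^ j * G lo j z" for lo j
    using G[of "real b * y" lo j "real (Suc a) * x"] assms by (simp add: z_def)
  have new: "pair_sum lo j a x' (Suc b) y' = (real b * y) ^ j * F lo j z" for lo j
    using F[of "real b * y" lo j "real (Suc a) * x"] assms by (simp add: z_def)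
  have oldw: "pair_sum lo j (Suc a) 1 b (real a / real b) = real a ^ j * G lo j w" for lo j
    using G[of "real a" lo j "real (Suc a)"] a by (simp add: w_def)
  \<comment> \<open>The weights \<open>1\<close> and \<open>a / b\<close> realize the extreme
    quotient \<open>w\<close>. Merging them leaves class sums \<open>a\<close> and
    \<open>a + 1\<close>, the larger one on the class of size \<open>b + 1 <= a\<close>;
    interchanging the sums reaches the target.\<close>
  have neww: "pair_sum lo j a 1 (Suc b) (real (Suc a) / real (Suc b)) \<le> real a ^ j * F lo j w"
    if "lo \<le> j" for lo j
  proof -
    have "pair_sum lo j a 1 (Suc b) (real (Suc a) / real (Suc b))
      \<le> pair_sum lo j a (real (Suc a) / real a) (Suc b) (real a / real (Suc b))"
      using pair_sum_swap[of "real a" "real (Suc a)" "Suc b" a lo j] assms a that by simp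
    also have "\<dots> = real a ^ j * F lo j w" using F a by (simp add: w_def)
    finally show ?thesis .
  qed
  have y'w: "(real b * (real a / real b) + 1) / real (Suc b) = real (Suc a) / real (Suc b)"
    using assms by simp
  have w0: "G 0 j w \<le> F 0 j w" for j
  proof -
    have "real a ^ j * G 0 j w \<le> pair_sum 0 j a 1 (Suc b) (real (Suc a) / real (Suc b))"
      using pair_sum_merge(1)[of 1 "real a / real b" j a b] assms a unfolding oldw y'w by simp
    also note neww[of 0 j, OF le0]
    finally have "real a ^ j * G 0 j w \<le> real a ^ j * F 0 j w" .
    then show ?thesis using a by (simp add: mult_le_cancel_left)
  qed
  \<comment> \<open>Strictness comes from \<open>alpha b (r - 1) < alpha a (r - 1)\<close>, for
    which \<open>2 <= r - 1\<close> and \<open>r - 1 <= a\<close> are used.\<close>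
  have w1: "G 1 r w < F 1 r w" if r: "3 \<le> r" "r \<le> Suc a" for r
  proof -
    have "real (b choose (r - 1)) * (real a / real b) ^ (r - 1) < real (a choose (r - 1))"
    proof -
      have "real (b choose (r - 1)) * (real a / real b) ^ (r - 1) = alpha b (r - 1) * real a ^ (r - 1)"
        by (simp add: alpha_def power_divide)
      also have "\<dots> < alpha a (r - 1) * real a ^ (r - 1)"
        using assms a r by (intro mult_strict_right_mono alpha_less) auto
      also have "\<dots> = real (a choose (r - 1))" using a by (simp add: alpha_def)
      finally show ?thesis .
    qed
    then have "real a ^ r * G 1 r w < pair_sum 1 r a 1 (Suc b) (real (Suc a) / real (Suc b))"
      using pair_sum_merge(2)[of 1 "real a / real b" r a b] assms a r unfolding oldw y'w by simp
    also have "\<dots> \<le> real a ^ r * F 1 r w" using r by (intro neww) auto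
    finally have "real a ^ r * G 1 r w < real a ^ r * F 1 r w" .
    then show ?thesis using a by (simp add: mult_less_cancel_left)
  qed
  have f0: "0 \<le> f j i" and g0: "0 \<le> g j i" for j i
    by (simp_all add: f_def g_def alpha_nonneg)
  \<comment> \<open>Up to zero denominators, \<open>alpha a i / alpha (Suc a) i\<close> and
    \<open>alpha (Suc b) (j - i) / alpha b (j - i)\<close> are nonincreasing in \<open>i\<close>,
    hence so is their product \<open>f j i / g j i\<close>.\<close>
  have ratio: "F lo j w * G lo j z \<le> F lo j z * G lo j w" for lo j
    unfolding F_def G_def
  proof (rule ratio_antimono)
    fix i l :: nat assume "i \<le> l"
    have "alpha a l * alpha (Suc a) i \<le> alpha (Suc a) l * alpha a i"
      using a \<open>i \<le> l\<close> by (intro alpha_ratio_mono) auto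
    moreover have "alpha b (j - i) * alpha (Suc b) (j - l) \<le> alpha (Suc b) (j - i) * alpha b (j - l)"
      using assms \<open>i \<le> l\<close> by (intro alpha_ratio_mono) auto
    ultimately have "(alpha a l * alpha (Suc a) i) * (alpha b (j - i) * alpha (Suc b) (j - l))
      \<le> (alpha (Suc a) l * alpha a i) * (alpha (Suc b) (j - i) * alpha b (j - l))"
      by (rule mult_mono) (simp_all add: alpha_nonneg)
    then show "f j l * g j i \<le> f j i * g j l"
      by (simp add: f_def g_def mult_ac)
  qed (use z in auto)
  have Gpos: "0 < G lo j w" if "0 < G lo j z" for lo j
  proof -
    have "G lo j z \<le> G lo j w" unfolding G_def
      using z by (intro sum_mono mult_left_mono power_mono g0) auto
    with that show ?thesis by simp
  qed
  have F0: "0 \<le> F lo j z" and G0: "0 \<le> G lo j z" for lo j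
    unfolding F_def G_def using z f0 g0 by (auto intro!: sum_nonneg)
  have "G 0 j z \<le> F 0 j z"
  \<comment> \<open>The old sum vanishes when \<open>j\<close> exceeds the number of vertices. It
    cannot be cancelled then, but the claim is trivial.\<close>
  proof (cases "G 0 j z = 0")
    case False
    then have p: "0 < G 0 j z" using G0[of 0 j] by simp
    have "G 0 j w * G 0 j z \<le> F 0 j w * G 0 j z" using w0 p by (intro mult_right_mono) auto
    also note ratio
    finally show ?thesis using Gpos[OF p] by (simp add: mult.commute mult_le_cancel_right)
  qed (use F0 in simp)
  then show "pair_sum 0 j (Suc a) x b y \<le> pair_sum 0 j a x' (Suc b) y'"
    unfolding old new using assms by (intro mult_left_mono) auto
  assume r: "3 \<le> r" "r \<le> Suc a"
  have "0 < g r (r - 1) * z ^ (r - 1)"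
    using r z assms by (auto simp: g_def intro!: mult_pos_pos alpha_pos)
  also have "\<dots> \<le> G 1 r z"
    unfolding G_def using r z g0 by (intro member_le_sum) auto
  finally have p: "0 < G 1 r z" .
  have "G 1 r w * G 1 r z < F 1 r w * G 1 r z" using w1[OF r] p by (rule mult_strict_right_mono)
  also note ratio
  finally have "G 1 r z < F 1 r z" using Gpos[OF p] by (simp add: mult.commute mult_less_cancel_right)
  then show "pair_sum 1 r (Suc a) x b y < pair_sum 1 r a x' (Suc b) y'"
    unfolding old new using assms by (intro mult_strict_left_mono) auto
qed

section \<open>Effect of the two moves on the p-norm\<close>

lemma convex_on_powr:
  assumes "(p :: real) \<ge> 1"
  shows "convex_on {0..} (\<lambda>x. x powr p)"
proof (rule convex_onI)
  fix t x y :: real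
  assume t: "0 < t" "t < 1" and xy: "x \<in> {0..}" "y \<in> {0..}"
  have aux: "(s * z) powr p \<le> s * z powr p" if "0 < s" "s < 1" "0 \<le> z" for s z :: real
    using that assms powr_mono'[of 1 p s] by (simp add: powr_mult mult_right_mono)
  show "((1 - t) *\<^sub>R x + t *\<^sub>R y) powr p \<le> (1 - t) * x powr p + t * y powr p"
  \<comment> \<open>Zero is allowed since averaging is later applied to vertices of weight zero.
    There the claim reduces to \<open>s powr p <= s\<close> for \<open>0 < s < 1\<close>.\<close>
  proof (cases "x = 0 \<or> y = 0")
    case True
    then show ?thesis using aux[of t y] aux[of "1 - t" x] t xy by auto
  next
    case False
    then show ?thesis
      using convex_onD[OF powr_convex[OF assms], of t x y] t xy by simp
  qed
qed simp

text \<open>Convexity with weights \<open>b / (b + 1)\<close> and \<open>1 / (b + 1)\<close>. It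
  controls the norm when a moved vertex is merged into a class and, for \<open>b = 1\<close>, when
  two weights are averaged.\<close>

lemma powr_merge_le:
  fixes p x y :: real
  assumes "1 \<le> p" "0 \<le> x" "0 \<le> y"
  shows "real (Suc b) * ((real b * y + x) / real (Suc b)) powr p \<le> real b * y powr p + x powr p"
proof -
  define t where "t = 1 / real (Suc b)"
  have t: "0 \<le> t" "t \<le> 1" "1 - t = real b / real (Suc b)"
    by (auto simp: t_def field_simps)
  have "((1 - t) *\<^sub>R y + t *\<^sub>R x) powr p \<le> (1 - t) * y powr p + t * x powr p"
    using t assms by (intro convex_onD[OF convex_on_powr]) auto
  also have "(1 - t) *\<^sub>R y + t *\<^sub>R x = (real b * y + x) / real (Suc b)"
    unfolding t(3) by (simp add: t_def add_divide_distrib)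
  also have "(1 - t) * y powr p + t * x powr p = (real b * y powr p + x powr p) / real (Suc b)"
    unfolding t(3) by (simp add: t_def add_divide_distrib)
  finally show ?thesis by (simp add: le_divide_eq mult.commute del: of_nat_Suc)
qed

text \<open>The norm counterpart of \<open>pair_sum_keep\<close>, by the same reduction: the claim
  is \<open>x powr p * C1 <= y powr p * C2\<close>. As \<open>C2 >= 0\<close> and
  \<open>a * x <= b * y\<close>, the case \<open>a * x = b * y\<close> suffices, where merging and
  then interchanging the class sums proves it.\<close>

lemma powr_keep_le:
  fixes p x y :: real
  assumes p: "1 \<le> p" and "0 < x" "0 < y" "0 < b" "b < a" "real a * x \<le> real b * y"
  shows "real a * (real (Suc a) * x / real a) powr p + real (Suc b) * (real b * y / real (Suc b)) powr p
    \<le> real (Suc a) * x powr p + real b * y powr p"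
proof -
  define A where "A = real a"
  define A' where "A' = real (Suc a)"
  define B where "B = real b"
  define B' where "B' = real (Suc b)"
  have pos: "0 < A" "0 < A'" "0 < B" "0 < B'" "B' \<le> A" "A \<le> A'"
    using assms by (auto simp: A_def A'_def B_def B'_def)
  have le: "A * x \<le> B * y" using assms by (simp add: A_def B_def)
  \<comment> \<open>\<open>C1\<close> is the cost of the raised weights per unit of
    \<open>x powr p\<close>; \<open>C2\<close> is what the lowered weights save per unit of
    \<open>y powr p\<close>.\<close>
  define C1 where "C1 = A * (A' / A) powr p - A'"
  define C2 where "C2 = B - B' * (B / B') powr p"
  have merge: "A + B' * (A' / B') powr p \<le> A' + B * (A / B) powr p"
    using powr_merge_le[of p 1 "A / B" b] p pos
    by (simp add: A_def A'_def B_def B'_def add.commute)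
  \<comment> \<open>The difference of the two sides is the product of
    \<open>A' powr p - A powr p\<close> and \<open>B' powr (1 - p) - A powr (1 - p)\<close>, both
    nonnegative since \<open>B' <= A <= A'\<close>.\<close>
  have swap: "A * (A' / A) powr p + B' * (A / B') powr p \<le> A + B' * (A' / B') powr p"
  proof -
    have "0 \<le> (A' powr p - A powr p) * (B' * (1 / B') powr p - A * (1 / A) powr p)"
    proof (rule mult_nonneg_nonneg)
      show "0 \<le> A' powr p - A powr p" using pos p by (simp add: powr_mono2)
      have eq: "c * (1 / c) powr p = (1 / c) powr (p - 1)" if "0 < c" for c :: real
        using that by (simp add: powr_diff powr_divide)
      have "(1 / A) powr (p - 1) \<le> (1 / B') powr (p - 1)"
        using pos p by (intro powr_mono2 divide_left_mono) auto
      then show "0 \<le> B' * (1 / B') powr p - A * (1 / A) powr p" using eq pos by simp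
    qed
    also have "\<dots> = A' powr p * (B' * (1 / B') powr p) - A powr p * (B' * (1 / B') powr p)
      - A' powr p * (A * (1 / A) powr p) + A * (A powr p * (1 / A) powr p)"
      by (simp add: algebra_simps)
    also have "A powr p * (1 / A) powr p = 1" using pos by (simp add: powr_divide)
    finally have "0 \<le> A' powr p * (B' * (1 / B') powr p) - A powr p * (B' * (1 / B') powr p)
      - A' powr p * (A * (1 / A) powr p) + A * 1" .
    moreover have "(A' / A) powr p = (1 / A) powr p * A' powr p"
      "(A / B') powr p = (1 / B') powr p * A powr p" "(A' / B') powr p = (1 / B') powr p * A' powr p"
      using pos by (simp_all add: powr_divide)
    ultimately show ?thesis by (simp add: mult_ac)
  qed
  have "C1 \<le> (A / B) powr p * C2"
  proof -
    have "(A / B) powr p * (B / B') powr p = (A / B') powr p"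
      using pos by (simp flip: powr_mult)
    then have "(A / B) powr p * C2 = B * (A / B) powr p - B' * (A / B') powr p"
      by (simp add: C2_def algebra_simps)
    then show ?thesis using merge swap by (simp add: C1_def)
  qed
  moreover have "0 \<le> C2"
  proof -
    have "(B / B') powr p \<le> (B / B') powr 1"
      using pos p by (intro powr_mono') (auto simp: B_def B'_def)
    then show ?thesis using pos by (simp add: C2_def field_simps)
  qed
  moreover have "(A * x) powr p \<le> (B * y) powr p"
    using le pos assms by (intro powr_mono2) auto
  ultimately have "(A * x) powr p * C1 \<le> (B * y) powr p * ((A / B) powr p * C2)"
    by (meson mult_left_mono mult_right_mono order_trans powr_ge_zero mult_nonneg_nonneg)
  also have "(B * y) powr p * ((A / B) powr p * C2) = (A * y) powr p * C2"
    using pos assms by (simp add: powr_mult powr_divide)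
  finally have "x powr p * C1 \<le> y powr p * C2"
    using pos assms by (simp add: powr_mult mult.assoc)
  moreover have "(A' * x / A) powr p = (A' / A) powr p * x powr p"
      "(B * y / B') powr p = (B / B') powr p * y powr p"
    using pos assms by (simp_all add: powr_divide powr_mult)
  ultimately show ?thesis
    unfolding C1_def C2_def A_def[symmetric] A'_def[symmetric] B_def[symmetric] B'_def[symmetric]
    by (simp add: algebra_simps)
qed

text \<open>The class sums are kept when \<open>a * x <= b * y\<close>; otherwise, and also when the
  smaller class is empty, the vertex takes its weight along. All degrees \<open>j\<close> are needed
  because the other classes multiply these sums by nonnegative coefficients.\<close>

lemma pair_transfer:
  fixes p x y :: real and a b r :: nat
  assumes "1 \<le> p" "0 < x" "0 < y" "b < a" "3 \<le> r" "r \<le> Suc a"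
  obtains x' y' where "0 < x'" "0 < y'"
    and "\<And>j. pair_sum 0 j (Suc a) x b y \<le> pair_sum 0 j a x' (Suc b) y'"
    and "pair_sum 1 r (Suc a) x b y < pair_sum 1 r a x' (Suc b) y'"
    and "real a * x' powr p + real (Suc b) * y' powr p \<le> real (Suc a) * x powr p + real b * y powr p"
proof (cases "0 < b \<and> real a * x \<le> real b * y")
  case True
  show ?thesis
  proof (rule that)
    show "0 < real (Suc a) * x / real a" "0 < real b * y / real (Suc b)" using True assms by auto
  qed (rule pair_sum_keep powr_keep_le; use True assms in simp)+
next
  case False
  have "real (b choose (r - 1)) * y ^ (r - 1) < real (a choose (r - 1)) * x ^ (r - 1)"
  proof (cases "b = 0")
    case True
    then show ?thesis using assms by (auto simp: binomial_eq_0)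
  next
    case b: False
    with False have lt: "real b * y < real a * x" by auto
    have "real (b choose (r - 1)) * y ^ (r - 1) = alpha b (r - 1) * (real b * y) ^ (r - 1)"
      using b by (simp add: alpha_def power_mult_distrib)
    also have "\<dots> \<le> alpha a (r - 1) * (real b * y) ^ (r - 1)"
      using b assms by (intro mult_right_mono less_imp_le[OF alpha_less]) auto
    also have "\<dots> < alpha a (r - 1) * (real a * x) ^ (r - 1)"
      using lt assms by (intro mult_strict_left_mono power_strict_mono alpha_pos) auto
    also have "\<dots> = real (a choose (r - 1)) * x ^ (r - 1)"
      using assms by (simp add: alpha_def power_mult_distrib)
    finally show ?thesis .
  qed
  then have less: "pair_sum 1 r (Suc a) x b y < pair_sum 1 r a x (Suc b) ((real b * y + x) / real (Suc b))"
    using pair_sum_merge(2)[of x y r a b] assms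
      mult_pos_pos[of x "real (a choose (r - 1)) * x ^ (r - 1) - real (b choose (r - 1)) * y ^ (r - 1)"]
    by linarith
  have norm: "real a * x powr p + real (Suc b) * ((real b * y + x) / real (Suc b)) powr p
    \<le> real (Suc a) * x powr p + real b * y powr p"
    using powr_merge_le[of p x y b] assms by (simp add: algebra_simps)
  have pos: "0 < (real b * y + x) / real (Suc b)"
    using assms by (intro divide_pos_pos add_nonneg_pos) auto
  show ?thesis
    by (rule that[OF assms(2) pos pair_sum_merge(1) less norm]) (use assms in simp_all)
qed

section \<open>Optimal vectors of complete chromatic graphs\<close>

definition esym :: "'a set \<Rightarrow> nat \<Rightarrow> ('a \<Rightarrow> real) \<Rightarrow> real" where
  "esym A j x = (\<Sum>T | T \<subseteq> A \<and> card T = j. \<Prod>v\<in>T. x v)"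

lemma esym_insert:
  assumes "finite A" "v \<notin> A"
  shows "esym (insert v A) (Suc j) x = esym A (Suc j) x + x v * esym A j x"
proof -
  let ?S = "\<lambda>A j. {T. T \<subseteq> A \<and> card T = j}"
  have fin: "finite (?S A j)" for j using assms by simp
  have "?S (insert v A) (Suc j) = ?S A (Suc j) \<union> insert v ` ?S A j"
  proof (intro equalityI subsetI)
    fix T assume T: "T \<in> ?S (insert v A) (Suc j)"
    show "T \<in> ?S A (Suc j) \<union> insert v ` ?S A j"
    proof (cases "v \<in> T")
      case True
      then have "T = insert v (T - {v})" "T - {v} \<in> ?S A j"
        using T by (auto simp: card_Diff_singleton)
      then show ?thesis by blast
    qed (use T in auto)
  next
    fix T assume "T \<in> ?S A (Suc j) \<union> insert v ` ?S A j"
    then show "T \<in> ?S (insert v A) (Suc j)"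
    proof
      assume "T \<in> insert v ` ?S A j"
      then obtain U where U: "T = insert v U" "U \<subseteq> A" "card U = j" by auto
      then have "finite U" "v \<notin> U" using assms finite_subset by blast+
      with U show ?thesis by auto
    qed auto
  qed
  then have "esym (insert v A) (Suc j) x
    = esym A (Suc j) x + (\<Sum>T\<in>insert v ` ?S A j. \<Prod>v\<in>T. x v)"
    unfolding esym_def using assms fin by (subst sum.union_disjoint[symmetric]) auto
  also have "(\<Sum>T\<in>insert v ` ?S A j. \<Prod>v\<in>T. x v) = (\<Sum>T\<in>?S A j. \<Prod>v\<in>insert v T. x v)"
    using assms by (intro sum.reindex_cong[of "insert v"]) (auto simp: inj_on_def)
  also have "\<dots> = (\<Sum>T\<in>?S A j. x v * (\<Prod>v\<in>T. x v))"
    using assms by (intro sum.cong refl prod.insert) (auto intro: finite_subset)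
  finally show ?thesis by (simp add: esym_def sum_distrib_left)
qed

lemma esym_0: "finite A \<Longrightarrow> esym A 0 x = 1"
proof -
  assume "finite A"
  then have "{T. T \<subseteq> A \<and> card T = 0} = {{}}" by (auto dest: finite_subset)
  then show ?thesis by (simp add: esym_def)
qed

lemma esym_coeff: "finite A \<Longrightarrow> esym A j x = coeff (\<Prod>v\<in>A. [:1, x v:]) j"
proof (induction A arbitrary: j rule: finite_induct)
  case empty
  show ?case
  proof (cases j)
    case (Suc i)
    have "{T::'a set. T = {} \<and> card T = Suc i} = {}" by auto
    then show ?thesis by (simp add: esym_def Suc)
  qed (simp add: esym_0)
next
  case (insert v A)
  then show ?case
    by (cases j) (simp_all add: esym_0 esym_insert coeff_pCons flip: insert.IH)
qed

lemma esym_const: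
  assumes "finite A" "\<And>v. v \<in> A \<Longrightarrow> x v = c"
  shows "esym A j x = real (card A choose j) * c ^ j"
proof -
  have "(\<Prod>v\<in>A. [:1, x v:]) = [:1, c:] ^ card A"
    using assms by simp
  then show ?thesis using assms(1) by (simp add: esym_coeff coeff_const_power)
qed

text \<open>Generalizes \<open>Q\<close> to arbitrary classes, so that a chromatic graph can be
  completed on its own vertex set and partition.\<close>

definition complete_chromatic :: "nat \<Rightarrow> nat \<Rightarrow> (nat \<Rightarrow> 'a set) \<Rightarrow> 'a hypergraph" where
  "complete_chromatic r k W =
     (\<Union>i<k. W i, {e. e \<subseteq> (\<Union>i<k. W i) \<and> card e = r \<and> (\<forall>i<k. \<not> e \<subseteq> W i)})"

lemma Q_eq: "Q r k ns = complete_chromatic r k (Q_class ns)"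
  by (simp add: Q_def complete_chromatic_def Let_def)

definition class_partition :: "nat \<Rightarrow> (nat \<Rightarrow> 'a set) \<Rightarrow> bool" where
  "class_partition k W \<longleftrightarrow> disjoint_family_on W {..<k} \<and> (\<forall>i<k. finite (W i))"

lemma class_partition_Q: "class_partition k (Q_class ns)"
  by (auto simp: class_partition_def disjoint_family_on_def Q_class_def)

lemma card_Q_class: "card (Q_class ns i) = ns i"
  by (simp add: Q_class_def)

lemma class_eq:
  "class_partition k W \<Longrightarrow> i < k \<Longrightarrow> l < k \<Longrightarrow> v \<in> W i \<Longrightarrow> v \<in> W l \<Longrightarrow> i = l"
  unfolding class_partition_def disjoint_family_on_def by blast

lemma r_graph_complete: "class_partition k W \<Longrightarrow> r_graph r (complete_chromatic r k W)"
  by (auto simp: r_graph_def complete_chromatic_def class_partition_def)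

lemma finite_edges: "r_graph r G \<Longrightarrow> finite (edges G)"
  unfolding r_graph_def by (rule finite_subset[of _ "Pow (verts G)"]) auto

lemma finite_edge: "r_graph r G \<Longrightarrow> e \<in> edges G \<Longrightarrow> finite e"
  unfolding r_graph_def by (auto intro: finite_subset)

lemma poly_form_complete:
  assumes W: "class_partition k W" and r: "0 < r"
  shows "poly_form r (complete_chromatic r k W) x
    = fact r * (esym (\<Union>i<k. W i) r x - (\<Sum>i<k. esym (W i) r x))"
proof -
  let ?V = "\<Union>i<k. W i" and ?E = "edges (complete_chromatic r k W)"
  let ?S = "\<lambda>A. {T. T \<subseteq> A \<and> card T = r}"
  have fV: "finite ?V" and fW: "\<And>i. i < k \<Longrightarrow> finite (W i)"
    using W by (auto simp: class_partition_def)
  have "?S ?V = ?E \<union> (\<Union>i<k. ?S (W i))"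
    by (auto simp: complete_chromatic_def)
  then have "esym ?V r x = (\<Sum>T\<in>?E \<union> (\<Union>i<k. ?S (W i)). \<Prod>v\<in>T. x v)"
    by (simp add: esym_def)
  also have "\<dots> = (\<Sum>T\<in>?E. \<Prod>v\<in>T. x v) + (\<Sum>T\<in>(\<Union>i<k. ?S (W i)). \<Prod>v\<in>T. x v)"
    using finite_edges[OF r_graph_complete[OF W]] fW
    by (intro sum.union_disjoint) (auto simp: complete_chromatic_def)
  also have "(\<Sum>T\<in>(\<Union>i<k. ?S (W i)). \<Prod>v\<in>T. x v) = (\<Sum>i<k. esym (W i) r x)"
    unfolding esym_def
  proof (rule sum.UNION_disjoint)
    \<comment> \<open>Only the empty set can lie in two different classes, and \<open>r > 0\<close>
      excludes it.\<close>
    show "\<forall>i\<in>{..<k}. \<forall>l\<in>{..<k}. i \<noteq> l \<longrightarrow> ?S (W i) \<inter> ?S (W l) = {}"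
    proof (intro ballI impI equals0I)
      fix i l T assume *: "i \<in> {..<k}" "l \<in> {..<k}" "i \<noteq> l" "T \<in> ?S (W i) \<inter> ?S (W l)"
      then obtain v where "v \<in> T" using r by (cases "T = {}") auto
      with * show False using class_eq[OF W, of i l v] by auto
    qed
  qed (use fW in auto)
  finally show ?thesis by (simp add: poly_form_def)
qed

text \<open>The value of the form (up to the factor \<open>fact r\<close>) when the \<open>i\<close>-th class consists of
  \<open>m i\<close> vertices of weight \<open>y i\<close>.\<close>

definition profile :: "nat \<Rightarrow> nat \<Rightarrow> (nat \<Rightarrow> nat) \<Rightarrow> (nat \<Rightarrow> real) \<Rightarrow> real" where
  "profile r k m y = coeff (\<Prod>i<k. [:1, y i:] ^ m i) r - (\<Sum>i<k. real (m i choose r) * y i ^ r)"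

lemma poly_form_profile:
  assumes W: "class_partition k W" and r: "0 < r"
    and x: "\<And>i v. i < k \<Longrightarrow> v \<in> W i \<Longrightarrow> x v = y i"
  shows "poly_form r (complete_chromatic r k W) x = fact r * profile r k (\<lambda>i. card (W i)) y"
proof -
  have fW: "\<And>i. i < k \<Longrightarrow> finite (W i)"
    using W by (auto simp: class_partition_def)
  have "(\<Prod>v\<in>(\<Union>i<k. W i). [:1, x v:]) = (\<Prod>i<k. \<Prod>v\<in>W i. [:1, x v:])"
    using W fW by (intro prod.UNION_disjoint) (auto simp: class_partition_def disjoint_family_on_def)
  also have "\<dots> = (\<Prod>i<k. [:1, y i:] ^ card (W i))"
    using x by (intro prod.cong refl) simp
  finally show ?thesis
    using fW x by (simp add: poly_form_complete[OF W r] profile_def esym_coeff[of "\<Union>i<k. W i"]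
        esym_const[where c = "y _"])
qed

lemma norm_profile:
  assumes W: "class_partition k W"
    and x: "\<And>i v. i < k \<Longrightarrow> v \<in> W i \<Longrightarrow> x v = y i"
  shows "(\<Sum>v\<in>(\<Union>i<k. W i). \<bar>x v\<bar> powr p) = (\<Sum>i<k. real (card (W i)) * \<bar>y i\<bar> powr p)"
proof -
  have "(\<Sum>v\<in>(\<Union>i<k. W i). \<bar>x v\<bar> powr p) = (\<Sum>i<k. \<Sum>v\<in>W i. \<bar>x v\<bar> powr p)"
    using W by (intro sum.UNION_disjoint) (auto simp: class_partition_def disjoint_family_on_def)
  also have "\<dots> = (\<Sum>i<k. real (card (W i)) * \<bar>y i\<bar> powr p)"
    using x by (intro sum.cong refl) simp
  finally show ?thesis .
qed

section \<open>Scaling and nonnegative optimal vectors\<close>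

lemma poly_form_nonneg:
  assumes "\<And>v. 0 \<le> x v"
  shows "0 \<le> poly_form r G x"
  using assms unfolding poly_form_def by (intro mult_nonneg_nonneg sum_nonneg prod_nonneg) auto

lemma poly_form_scale:
  assumes "r_graph r G"
  shows "poly_form r G (\<lambda>v. c * x v) = c ^ r * poly_form r G x"
proof -
  have "(\<Sum>e\<in>edges G. \<Prod>v\<in>e. c * x v) = (\<Sum>e\<in>edges G. c ^ r * (\<Prod>v\<in>e. x v))"
    using assms by (intro sum.cong refl) (auto simp: prod.distrib r_graph_def)
  then show ?thesis by (simp add: poly_form_def sum_distrib_left mult_ac)
qed

lemma const_norm:
  assumes "finite V" "V \<noteq> {}" "(p :: real) \<ge> 1"
  shows "(\<Sum>v\<in>V. \<bar>real (card V) powr (- 1 / p)\<bar> powr p) = 1"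
proof -
  have "0 < card V" using assms by (simp add: card_gt_0_iff)
  then have "(real (card V) powr (- 1 / p)) powr p = inverse (real (card V))"
    unfolding powr_powr using assms by (simp add: powr_minus)
  then show ?thesis using \<open>0 < card V\<close> by simp
qed

lemma radius_nonneg:
  assumes "r_graph r G" "verts G \<noteq> {}" "(p :: real) \<ge> 1"
  shows "0 \<le> p_spectral_radius r p G"
proof -
  have "finite (verts G)" using assms by (simp add: r_graph_def)
  from p_spectral_radius_attained(2)[OF assms const_norm[OF this assms(2,3)]]
  show ?thesis using poly_form_nonneg[of "\<lambda>_. real (card (verts G)) powr (- 1 / p)" r G] by simp
qed

text \<open>A norm below 1 leaves room to scale the vector up, which does not decrease a nonnegative
  form. Hence a modified vector whose norm has dropped can be used directly.\<close>

lemma radius_ge: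
  assumes G: "r_graph r G" "verts G \<noteq> {}" and p: "(p :: real) \<ge> 1" and r: "0 < r"
    and x: "(\<Sum>v\<in>verts G. \<bar>x v\<bar> powr p) \<le> 1" "0 \<le> poly_form r G x"
  shows "poly_form r G x \<le> p_spectral_radius r p G"
proof -
  define N where "N = (\<Sum>v\<in>verts G. \<bar>x v\<bar> powr p)"
  have fin: "finite (verts G)" using G by (simp add: r_graph_def)
  have "0 \<le> N" unfolding N_def by (intro sum_nonneg) auto
  show ?thesis
  proof (cases "N = 0")
    \<comment> \<open>A zero vector cannot be normalized, but then all edge products vanish.\<close>
    case True
    then have x0: "x v = 0" if "v \<in> verts G" for v
      using fin that unfolding N_def by (subst (asm) sum_nonneg_eq_0_iff) auto
    have "(\<Prod>v\<in>e. x v) = 0" if e: "e \<in> edges G" for e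
    proof -
      have "e \<noteq> {}" "e \<subseteq> verts G" "finite e"
        using G e r finite_edge[OF G(1) e] by (auto simp: r_graph_def)
      then show ?thesis using x0 by (auto simp: prod_zero_iff)
    qed
    then have "poly_form r G x = 0" by (simp add: poly_form_def)
    then show ?thesis using radius_nonneg[OF G p] by simp
  next
    case False
    with \<open>0 \<le> N\<close> have N: "0 < N" "N \<le> 1" using x by (auto simp: N_def)
    define c where "c = N powr (- 1 / p)"
    have cp: "c powr p = 1 / N" unfolding c_def powr_powr using p N by (simp add: powr_minus_divide)
    have "c \<ge> 1"
    proof -
      have "N powr 0 \<le> N powr (- 1 / p)" using N p by (intro powr_mono') auto
      then show ?thesis using N by (simp add: c_def)
    qed
    have "(\<Sum>v\<in>verts G. \<bar>c * x v\<bar> powr p) = c powr p * N"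
      using \<open>c \<ge> 1\<close> by (simp add: N_def abs_mult powr_mult sum_distrib_left)
    then have "(\<Sum>v\<in>verts G. \<bar>c * x v\<bar> powr p) = 1" using N cp by simp
    from p_spectral_radius_attained(2)[OF G p this]
    have "c ^ r * poly_form r G x \<le> p_spectral_radius r p G"
      by (simp add: poly_form_scale[OF G(1)])
    moreover have "1 * poly_form r G x \<le> c ^ r * poly_form r G x"
      using x(2) \<open>c \<ge> 1\<close> by (intro mult_right_mono one_le_power) auto
    ultimately show ?thesis by simp
  qed
qed

lemma radius_attained_nonneg:
  assumes G: "r_graph r G" "verts G \<noteq> {}" and p: "(p :: real) \<ge> 1"
  shows "\<exists>x. (\<forall>v. 0 \<le> x v) \<and> (\<Sum>v\<in>verts G. x v powr p) = 1 \<and>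
    poly_form r G x = p_spectral_radius r p G"
proof -
  obtain x where x: "(\<Sum>v\<in>verts G. \<bar>x v\<bar> powr p) = 1" "poly_form r G x = p_spectral_radius r p G"
    using p_spectral_radius_attained(1)[OF G p] by blast
  have "poly_form r G x \<le> poly_form r G (\<lambda>v. \<bar>x v\<bar>)"
    unfolding poly_form_def
  proof (intro mult_left_mono sum_mono)
    fix e
    show "(\<Prod>v\<in>e. x v) \<le> (\<Prod>v\<in>e. \<bar>x v\<bar>)" by (metis abs_ge_self abs_prod)
  qed simp
  moreover have "poly_form r G (\<lambda>v. \<bar>x v\<bar>) \<le> p_spectral_radius r p G"
    using x by (intro p_spectral_radius_attained(2)[OF G p]) simp
  ultimately show ?thesis using x by (intro exI[of _ "\<lambda>v. \<bar>x v\<bar>"]) auto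
qed

section \<open>Averaging two weights and the shape of optimal vectors\<close>

lemma sum_edges_split:
  fixes x :: "'a \<Rightarrow> real"
  assumes E: "finite E" "\<And>e. e \<in> E \<Longrightarrow> finite e" and "u \<noteq> v"
  shows "(\<Sum>e\<in>E. prod x e) = (\<Sum>e | e \<in> E \<and> u \<notin> e \<and> v \<notin> e. prod x e)
    + x u * (\<Sum>e | e \<in> E \<and> u \<in> e \<and> v \<notin> e. prod x (e - {u}))
    + x v * (\<Sum>e | e \<in> E \<and> v \<in> e \<and> u \<notin> e. prod x (e - {v}))
    + x u * x v * (\<Sum>e | e \<in> E \<and> u \<in> e \<and> v \<in> e. prod x (e - {u, v}))"
proof -
  \<comment> \<open>Sorting the edges by which of \<open>u\<close> and \<open>v\<close> they contain
    makes the form affine in each of the two weights, with coefficients free of both.\<close>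
  have "(\<Sum>e\<in>E. prod x e) =
    (\<Sum>e\<in>E. (if u \<notin> e \<and> v \<notin> e then prod x e else 0)
    + (if u \<in> e \<and> v \<notin> e then x u * prod x (e - {u}) else 0)
    + (if v \<in> e \<and> u \<notin> e then x v * prod x (e - {v}) else 0)
    + (if u \<in> e \<and> v \<in> e then x u * x v * prod x (e - {u, v}) else 0))"
  proof (intro sum.cong refl)
    fix e assume "e \<in> E"
    then have fin: "finite e" using E by auto
    have u: "prod x e = x u * prod x (e - {u})" if "u \<in> e"
      using fin that by (rule prod.remove)
    have v: "prod x e = x v * prod x (e - {v})" if "v \<in> e"
      using fin that by (rule prod.remove)
    have uv: "prod x e = x u * x v * prod x (e - {u, v})" if "u \<in> e" "v \<in> e"
    proof -
      have "prod x (e - {u}) = x v * prod x (e - {u} - {v})"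
        using fin that assms(3) by (intro prod.remove) auto
      then show ?thesis unfolding u[OF that(1)] Diff_insert2[of e u "{v}"] by simp
    qed
    show "prod x e = (if u \<notin> e \<and> v \<notin> e then prod x e else 0)
      + (if u \<in> e \<and> v \<notin> e then x u * prod x (e - {u}) else 0)
      + (if v \<in> e \<and> u \<notin> e then x v * prod x (e - {v}) else 0)
      + (if u \<in> e \<and> v \<in> e then x u * x v * prod x (e - {u, v}) else 0)"
      by (cases "u \<in> e"; cases "v \<in> e") (simp add: uv, simp add: u, simp add: v, simp)
  qed
  then show ?thesis
    unfolding sum.distrib unfolding sum_distrib_left unfolding sum.inter_filter[OF E(1)] by simp
qed

text \<open>Replacing two unequal weights by their average keeps the weight sum, does not increase the
  norm, and gains at least the product term \<open>(x v - x u)\<^sup>2 / 4\<close> times the common link.\<close>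

lemma optimal_average:
  fixes x :: "'a \<Rightarrow> real"
  assumes G: "r_graph r G" and p: "1 \<le> p" and r: "0 < r"
    and x0: "\<And>v. 0 \<le> x v" and norm: "(\<Sum>v\<in>verts G. x v powr p) = 1"
    and opt: "poly_form r G x = p_spectral_radius r p G"
    and uv: "u \<in> verts G" "v \<in> verts G"
    and shift: "\<And>e. e \<in> edges G \<Longrightarrow> v \<in> e \<Longrightarrow> u \<notin> e \<Longrightarrow> (\<And>w. w \<in> e - {v} \<Longrightarrow> 0 < x w)
      \<Longrightarrow> insert u (e - {v}) \<in> edges G"
    and common: "e \<in> edges G" "u \<in> e" "v \<in> e" "\<And>w. w \<in> e - {u, v} \<Longrightarrow> 0 < x w"
  shows "x v \<le> x u"
proof (rule ccontr)
  assume "\<not> x v \<le> x u"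
  then have less: "x u < x v" by simp
  then have "u \<noteq> v" by auto
  have fE: "finite (edges G)" and fe: "\<And>e. e \<in> edges G \<Longrightarrow> finite e"
    using finite_edges[OF G] finite_edge[OF G] by auto
  have fV: "finite (verts G)" using G by (simp add: r_graph_def)
  define m where "m = (x u + x v) / 2"
  define x' where "x' = x(u := m, v := m)"
  define P where "P = (\<Sum>e | e \<in> edges G \<and> u \<notin> e \<and> v \<notin> e. prod x e)"
  define U where "U = (\<Sum>e | e \<in> edges G \<and> u \<in> e \<and> v \<notin> e. prod x (e - {u}))"
  define L where "L = (\<Sum>e | e \<in> edges G \<and> v \<in> e \<and> u \<notin> e. prod x (e - {v}))"
  define C where "C = (\<Sum>e | e \<in> edges G \<and> u \<in> e \<and> v \<in> e. prod x (e - {u, v}))"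
  have pos: "0 \<le> prod x e" for e using x0 by (intro prod_nonneg) auto
  have "0 < prod x (e - {u, v})" using common(4) by (intro prod_pos) auto
  also have "\<dots> \<le> C" unfolding C_def
    using fE common pos by (intro member_le_sum[of e]) auto
  finally have C: "0 < C" .
  have LU: "L \<le> U"
  proof -
    \<comment> \<open>Links of weight zero are dropped first, because \<open>shift\<close> is
      available only when all other weights of the edge are positive.\<close>
    let ?Ev = "{e \<in> edges G. v \<in> e \<and> u \<notin> e \<and> prod x (e - {v}) \<noteq> 0}"
    have "L = (\<Sum>e\<in>?Ev. prod x (e - {v}))"
      unfolding L_def using fE by (intro sum.mono_neutral_right) auto
    also have "\<dots> = (\<Sum>e\<in>(\<lambda>e. insert u (e - {v})) ` ?Ev. prod x (e - {u}))"
    proof (rule sum.reindex_cong[symmetric])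
      show "inj_on (\<lambda>e. insert u (e - {v})) ?Ev"
        by (rule inj_on_inverseI[of _ "\<lambda>e. insert v (e - {u})"]) auto
      show "prod x (insert u (e - {v}) - {u}) = prod x (e - {v})" if "e \<in> ?Ev" for e
        using that by (simp add: insert_Diff_if)
    qed simp
    also have "\<dots> \<le> U" unfolding U_def
    proof (rule sum_mono2)
      show "(\<lambda>e. insert u (e - {v})) ` ?Ev \<subseteq> {e. e \<in> edges G \<and> u \<in> e \<and> v \<notin> e}"
      proof
        fix f assume "f \<in> (\<lambda>e. insert u (e - {v})) ` ?Ev"
        then obtain e where e: "f = insert u (e - {v})" "e \<in> ?Ev" by blast
        then have "0 < x w" if "w \<in> e - {v}" for w
          using that fe[of e] x0[of w] by (auto simp: prod_zero_iff less_le)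
        with e show "f \<in> {e. e \<in> edges G \<and> u \<in> e \<and> v \<notin> e}"
          using shift[of e] \<open>u \<noteq> v\<close> by auto
      qed
    qed (use fE pos in auto)
    finally show ?thesis .
  qed
  have S: "(\<Sum>e\<in>edges G. prod x e) = P + x u * U + x v * L + x u * x v * C"
    unfolding P_def U_def L_def C_def by (rule sum_edges_split[OF fE fe \<open>u \<noteq> v\<close>])
  have agree: "prod x' f = prod x f" if "u \<notin> f" "v \<notin> f" for f
    using that by (intro prod.cong) (auto simp: x'_def)
  have "(\<Sum>e | e \<in> edges G \<and> u \<notin> e \<and> v \<notin> e. prod x' e) = P"
    "(\<Sum>e | e \<in> edges G \<and> u \<in> e \<and> v \<notin> e. prod x' (e - {u})) = U"
    "(\<Sum>e | e \<in> edges G \<and> v \<in> e \<and> u \<notin> e. prod x' (e - {v})) = L"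
    "(\<Sum>e | e \<in> edges G \<and> u \<in> e \<and> v \<in> e. prod x' (e - {u, v})) = C"
    unfolding P_def U_def L_def C_def by (rule sum.cong[OF refl], rule agree; simp)+
  then have "(\<Sum>e\<in>edges G. prod x' e) = P + x' u * U + x' v * L + x' u * x' v * C"
    using sum_edges_split[OF fE fe \<open>u \<noteq> v\<close>, of x'] by simp
  then have S': "(\<Sum>e\<in>edges G. prod x' e) = P + m * U + m * L + m * m * C"
    using \<open>u \<noteq> v\<close> by (simp add: x'_def)
  have "P + m * U + m * L + m * m * C - (P + x u * U + x v * L + x u * x v * C)
    = (U - L) * ((x v - x u) / 2) + C * ((x v - x u) / 2) ^ 2"
    by (simp add: m_def field_simps power2_eq_square)
  also have "\<dots> > 0"
    using LU C less by (intro add_nonneg_pos mult_nonneg_nonneg mult_pos_pos) auto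
  finally have gain: "poly_form r G x < poly_form r G x'"
    unfolding poly_form_def S S' by simp
  have x'0: "0 \<le> x' w" for w using x0 by (simp add: x'_def m_def)
  have split: "(\<Sum>w\<in>verts G. f w) = f u + f v + (\<Sum>w\<in>verts G - {u, v}. f w)" for f :: "'a \<Rightarrow> real"
    using sum.remove[OF fV uv(1), of f] sum.remove[of "verts G - {u}" v f] fV uv \<open>u \<noteq> v\<close>
    unfolding Diff_insert2[of "verts G" u "{v}"] by simp
  have "2 * m powr p \<le> x u powr p + x v powr p"
    using powr_merge_le[of p "x u" "x v" 1] p x0 by (simp add: m_def add.commute)
  moreover have "(\<Sum>w\<in>verts G - {u, v}. x' w powr p) = (\<Sum>w\<in>verts G - {u, v}. x w powr p)"
    by (intro sum.cong) (auto simp: x'_def)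
  ultimately have "(\<Sum>w\<in>verts G. x' w powr p) \<le> (\<Sum>w\<in>verts G. x w powr p)"
    using split[of "\<lambda>w. x' w powr p"] split[of "\<lambda>w. x w powr p"] \<open>u \<noteq> v\<close>
    by (simp add: x'_def)
  then have "poly_form r G x' \<le> p_spectral_radius r p G"
    using uv x'0 norm by (intro radius_ge[OF G _ p r] poly_form_nonneg) auto
  with gain opt show False by simp
qed

lemma radius_pos:
  assumes G: "r_graph r G" and p: "(p :: real) \<ge> 1" and r: "0 < r" and e: "edges G \<noteq> {}"
  shows "0 < p_spectral_radius r p G"
proof -
  obtain f where f: "f \<in> edges G" using e by blast
  then have V: "verts G \<noteq> {}" using G r by (fastforce simp: r_graph_def)
  have fin: "finite (verts G)" using G by (simp add: r_graph_def)
  define c where "c = real (card (verts G)) powr (- 1 / p)"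
  have "0 < c" using V fin by (simp add: c_def)
  then have "0 < poly_form r G (\<lambda>_. c)"
    unfolding poly_form_def using finite_edges[OF G] e by (intro mult_pos_pos sum_pos prod_pos) auto
  also have "\<dots> \<le> p_spectral_radius r p G"
    using const_norm[OF fin V p] by (intro p_spectral_radius_attained(2)[OF G V p]) (simp add: c_def)
  finally show ?thesis .
qed

lemma poly_form_pos_edge:
  assumes "\<And>v. 0 \<le> x v" "0 < poly_form r G x" "r_graph r G"
  obtains e where "e \<in> edges G" "\<And>v. v \<in> e \<Longrightarrow> 0 < x v"
proof -
  have "\<not> (\<Sum>e\<in>edges G. \<Prod>v\<in>e. x v) \<le> 0"
    using assms(2) by (auto simp: poly_form_def mult_le_0_iff not_le zero_less_mult_iff)
  then obtain e where e: "e \<in> edges G" "\<not> (\<Prod>v\<in>e. x v) \<le> 0"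
    by (meson sum_nonpos)
  then have "x v \<noteq> 0" if "v \<in> e" for v
    using that finite_edge[OF assms(3) e(1)] prod_zero e(2) by (metis order_refl)
  with e assms(1) show ?thesis by (intro that[of e]) (auto simp: less_le)
qed

lemma edges_complete:
  "e \<in> edges (complete_chromatic r k W) \<longleftrightarrow>
    e \<subseteq> (\<Union>i<k. W i) \<and> card e = r \<and> (\<forall>i<k. \<not> e \<subseteq> W i)"
  by (simp add: complete_chromatic_def)

lemma verts_complete: "verts (complete_chromatic r k W) = (\<Union>i<k. W i)"
  by (simp add: complete_chromatic_def)

lemma edge_completeI:
  assumes "class_partition k W" "e \<subseteq> (\<Union>i<k. W i)" "card e = r" "i < k" "u \<in> e" "u \<in> W i"
    "w \<in> e" "w \<notin> W i"
  shows "e \<in> edges (complete_chromatic r k W)"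
  using assms class_eq[OF assms(1)] unfolding edges_complete by blast

text \<open>Both claims apply \<open>optimal_average\<close>, which needs an edge through the two
  vertices whose other weights are positive. Such edges are built from an edge \<open>f\<close> of
  positive weights, which exists because the radius is positive.\<close>

lemma optimal_complete:
  fixes x :: "'a \<Rightarrow> real"
  assumes W: "class_partition k W" and p: "1 \<le> p" and r: "3 \<le> r"
    and x0: "\<And>v. 0 \<le> x v" and norm: "(\<Sum>v\<in>(\<Union>i<k. W i). x v powr p) = 1"
    and opt: "poly_form r (complete_chromatic r k W) x = p_spectral_radius r p (complete_chromatic r k W)"
    and pos: "0 < p_spectral_radius r p (complete_chromatic r k W)"
  shows "\<And>i u v. i < k \<Longrightarrow> u \<in> W i \<Longrightarrow> v \<in> W i \<Longrightarrow> x u = x v"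
    and "\<And>i u. i < k \<Longrightarrow> u \<in> W i \<Longrightarrow> 0 < x u"
proof -
  let ?G = "complete_chromatic r k W" and ?V = "\<Union>i<k. W i"
  have G: "r_graph r ?G" by (rule r_graph_complete[OF W])
  obtain f where f: "f \<in> edges ?G" "\<And>v. v \<in> f \<Longrightarrow> 0 < x v"
    using poly_form_pos_edge[of x r ?G] x0 pos opt G by metis
  have fin: "finite f" using finite_edge[OF G f(1)] .
  have fV: "f \<subseteq> ?V" "card f = r" using f by (auto simp: edges_complete)
  note avg = optimal_average[OF G p _ x0 _ opt, unfolded verts_complete, OF _ norm]
  have le: "x v \<le> x u" if uv: "i < k" "u \<in> W i" "v \<in> W i" "u \<noteq> v" for i u v
  proof -
    obtain w where w: "w \<in> f" "w \<notin> W i"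
      using f(1) uv(1) unfolding edges_complete by blast
    \<comment> \<open>The common edge consists of \<open>u\<close>, \<open>v\<close>, a vertex
      \<open>w\<close> of \<open>f\<close> outside the class, and \<open>r - 3\<close> further
      vertices of \<open>f\<close>.\<close>
    have "r - 3 \<le> card (f - {w, u, v})"
      using fin fV(2) diff_card_le_card_Diff[of "{w, u, v}" f] card_insert_le_m1[of 3 "{u, v}" w]
        card_insert_le_m1[of 2 "{v}" u] by simp
    then obtain T where T: "T \<subseteq> f - {w, u, v}" "card T = r - 3" "finite T"
      by (rule obtain_subset_with_card_n)
    define e where "e = insert w (insert u (insert v T))"
    have wuv: "w \<noteq> u" "w \<noteq> v" using w uv by auto
    show ?thesis
    proof (rule avg)
      show "e \<in> edges ?G"
      proof (rule edge_completeI[OF W _ _ uv(1), of _ _ u w])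
        have "v \<notin> T" "u \<notin> insert v T" "w \<notin> insert u (insert v T)" using T wuv uv by auto
        then show "card e = r" using T r unfolding e_def by simp
        show "e \<subseteq> ?V" using T fV w uv unfolding e_def by blast
      qed (use uv w in \<open>auto simp: e_def\<close>)
      show "0 < x z" if "z \<in> e - {u, v}" for z
        using that T w f(2) by (auto simp: e_def)
      show "insert u (e' - {v}) \<in> edges ?G" if e': "e' \<in> edges ?G" "v \<in> e'" "u \<notin> e'" for e'
      proof -
        obtain z where z: "z \<in> e'" "z \<notin> W i"
          using e'(1) uv(1) unfolding edges_complete by blast
        show ?thesis
        proof (rule edge_completeI[OF W _ _ uv(1), of _ _ u z])
          have "finite e'" using finite_edge[OF G e'(1)] .
          then show "card (insert u (e' - {v})) = r"
            using e' r by (simp add: edges_complete card_Diff_singleton)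
        qed (use e' z uv in \<open>auto simp: edges_complete\<close>)
      qed
    qed (use r uv in \<open>auto simp: e_def\<close>)
  qed
  show const: "x u = x v" if "i < k" "u \<in> W i" "v \<in> W i" for i u v
  proof (cases "u = v")
    case False
    show ?thesis by (rule order.antisym; rule le) (use that False in auto)
  qed simp
  show "0 < x u" if u: "i < k" "u \<in> W i" for i u
  proof (rule ccontr)
    assume "\<not> 0 < x u"
    then have xu: "x u = 0" using x0[of u] by simp
    \<comment> \<open>A zero weight spreads to the whole class, so a set containing \<open>u\<close>
      and a vertex of positive weight is never inside a class.\<close>
    have out: "z \<notin> W i" if "0 < x z" for z using const[OF u(1) u(2), of z] xu that by auto
    obtain v where v: "v \<in> f" using fV(2) r by fastforce
    have "f - {v} \<noteq> {}"
    proof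
      assume "f - {v} = {}"
      then have "f \<subseteq> {v}" by blast
      then show False using fV(2) r card_mono[of "{v}" f] by simp
    qed
    then obtain w where w: "w \<in> f" "w \<noteq> v" by auto
    have uf: "u \<notin> f" using f(2)[of u] xu by auto
    \<comment> \<open>The common edge of \<open>u\<close> and \<open>v\<close> arises from
      \<open>f\<close> by exchanging another vertex \<open>w\<close> for \<open>u\<close>.\<close>
    have "x v \<le> x u"
    proof (rule avg)
      show "insert u (f - {w}) \<in> edges ?G"
      proof (rule edge_completeI[OF W _ _ u(1), of _ _ u v])
        show "card (insert u (f - {w})) = r"
          using fin uf w fV r by (simp add: card_Diff_singleton)
      qed (use u v w fV f(2) out in auto)
      show "insert u (e' - {v}) \<in> edges ?G"
        if e': "e' \<in> edges ?G" "v \<in> e'" "u \<notin> e'" and *: "\<And>w. w \<in> e' - {v} \<Longrightarrow> 0 < x w" for e'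
      proof -
        have fe: "finite e'" using finite_edge[OF G e'(1)] .
        have "e' - {v} \<noteq> {}"
        proof
          assume "e' - {v} = {}"
          then have "e' \<subseteq> {v}" by blast
          then show False using e' r card_mono[of "{v}" e'] by (simp add: edges_complete)
        qed
        then obtain z where z: "z \<in> e' - {v}" by auto
        show ?thesis
        proof (rule edge_completeI[OF W _ _ u(1), of _ _ u z])
          show "card (insert u (e' - {v})) = r"
            using e' fe r by (simp add: edges_complete card_Diff_singleton)
        qed (use e' z u *[OF z] out in \<open>auto simp: edges_complete\<close>)
      qed
    qed (use r u v fV f(2) w in auto)
    then show False using f(2)[OF v] xu by simp
  qed
qed

lemma radius_complete_profile:
  assumes W: "class_partition k W" and p: "(p :: real) \<ge> 1" and r: "3 \<le> r"
    and V: "(\<Union>i<k. W i) \<noteq> {}"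
  obtains y where "\<And>i. i < k \<Longrightarrow> 0 < y i" "(\<Sum>i<k. real (card (W i)) * y i powr p) = 1"
    "p_spectral_radius r p (complete_chromatic r k W) = fact r * profile r k (\<lambda>i. card (W i)) y"
proof -
  let ?G = "complete_chromatic r k W" and ?V = "\<Union>i<k. W i"
  have G: "r_graph r ?G" by (rule r_graph_complete[OF W])
  have GV: "verts ?G \<noteq> {}" using V by (simp add: verts_complete)
  have fV: "finite ?V" using W by (auto simp: class_partition_def)
  obtain x where x: "\<And>v. 0 \<le> x v" "(\<Sum>v\<in>?V. x v powr p) = 1"
    "poly_form r ?G x = p_spectral_radius r p ?G"
    "\<And>i u v. i < k \<Longrightarrow> u \<in> W i \<Longrightarrow> v \<in> W i \<Longrightarrow> x u = x v"
    "\<And>i u. i < k \<Longrightarrow> u \<in> W i \<Longrightarrow> 0 < x u"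
  proof (cases "0 < p_spectral_radius r p ?G")
    case True
    obtain x where x: "\<And>v. 0 \<le> x v" "(\<Sum>v\<in>?V. x v powr p) = 1"
      "poly_form r ?G x = p_spectral_radius r p ?G"
      using radius_attained_nonneg[OF G GV p] unfolding verts_complete by blast
    show ?thesis
    proof (rule that[OF x])
      show "x u = x v" if "i < k" "u \<in> W i" "v \<in> W i" for i u v
        using optimal_complete(1)[OF W p r x True that] .
      show "0 < x u" if "i < k" "u \<in> W i" for i u
        using optimal_complete(2)[OF W p r x True that] .
    qed
  next
    \<comment> \<open>With radius zero \<open>optimal_complete\<close> does not apply, but the form
      of the positive constant vector is squeezed to 0, so this vector is optimal.\<close>
    case False
    then have 0: "p_spectral_radius r p ?G = 0" using radius_nonneg[OF G GV p] by simp
    define c where "c = real (card ?V) powr (- 1 / p)"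
    have c: "0 < c" using V fV by (simp add: c_def card_gt_0_iff)
    have norm: "(\<Sum>v\<in>?V. \<bar>c\<bar> powr p) = 1"
      unfolding c_def by (rule const_norm[OF fV V p])
    have "poly_form r ?G (\<lambda>_. c) \<le> 0"
      using p_spectral_radius_attained(2)[OF G GV p, unfolded verts_complete, OF norm] 0 by simp
    moreover have "0 \<le> poly_form r ?G (\<lambda>_. c)" using c by (intro poly_form_nonneg) simp
    ultimately have "poly_form r ?G (\<lambda>_. c) = p_spectral_radius r p ?G" using 0 by simp
    then show ?thesis by (rule that[rotated 2]) (use c norm in simp_all)
  qed
  \<comment> \<open>Empty classes get the default weight 1: such a class may receive a vertex, and
    \<open>pair_transfer\<close> asks for a positive weight.\<close>
  define y where "y i = (if W i = {} then 1 else x (SOME v. v \<in> W i))" for i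
  have y: "x v = y i" if "i < k" "v \<in> W i" for i v
  proof -
    have "(SOME u. u \<in> W i) \<in> W i" using that(2) by (rule someI)
    from x(4)[OF that this] that(2) show ?thesis by (auto simp: y_def)
  qed
  have ypos: "0 < y i" if "i < k" for i
  proof (cases "W i = {}")
    case False
    then obtain v where "v \<in> W i" by blast
    from y[OF that this] x(5)[OF that this] show ?thesis by simp
  qed (simp add: y_def)
  show ?thesis
  proof (rule that[of y])
    have "(\<Sum>i<k. real (card (W i)) * y i powr p) = (\<Sum>i<k. real (card (W i)) * \<bar>y i\<bar> powr p)"
      using ypos by (intro sum.cong refl) (simp add: abs_of_pos)
    also have "\<dots> = 1" using norm_profile[OF W y, where p = p] x(1,2) by simp
    finally show "(\<Sum>i<k. real (card (W i)) * y i powr p) = 1" .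
    show "p_spectral_radius r p ?G = fact r * profile r k (\<lambda>i. card (W i)) y"
      unfolding x(3)[symmetric] using r y by (intro poly_form_profile[OF W]) auto
  qed (use ypos in auto)
qed


section \<open>Comparing class sizes\<close>

lemma coeff_prod_nonneg:
  fixes P :: "'b \<Rightarrow> real poly"
  assumes "\<And>l n. l \<in> S \<Longrightarrow> 0 \<le> coeff (P l) n"
  shows "0 \<le> coeff (\<Prod>l\<in>S. P l) n"
  using assms
proof (induction S arbitrary: n rule: infinite_finite_induct)
  case (insert l S)
  then show ?case by (simp add: coeff_mult sum_nonneg)
qed simp_all

lemma coeff_0_prod: "coeff (\<Prod>l\<in>S. P l) 0 = (\<Prod>l\<in>S. coeff (P l) 0)"
  by (induction S rule: infinite_finite_induct) (simp_all add: coeff_mult)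

lemma sum_split_pair:
  fixes f :: "nat \<Rightarrow> 'b::comm_monoid_add"
  assumes "i < k" "j < k" "i \<noteq> j"
  shows "(\<Sum>l<k. f l) = f i + (f j + (\<Sum>l\<in>{..<k} - {i, j}. f l))"
  using assms sum.remove[of "{..<k}" i f] sum.remove[of "{..<k} - {i}" j f]
  unfolding Diff_insert2[of _ i "{j}"] by simp

lemma prod_split_pair:
  fixes f :: "nat \<Rightarrow> 'b::comm_monoid_mult"
  assumes "i < k" "j < k" "i \<noteq> j"
  shows "(\<Prod>l<k. f l) = f i * (f j * (\<Prod>l\<in>{..<k} - {i, j}. f l))"
  using assms prod.remove[of "{..<k}" i f] prod.remove[of "{..<k} - {i}" j f]
  unfolding Diff_insert2[of _ i "{j}"] by simp

text \<open>In the product over all classes the pair contributes degree \<open>t\<close> and the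
  rest degree \<open>r - t\<close>. For \<open>t = r\<close> the rest contributes 1, and subtracting
  the terms inside the two classes turns \<open>pair_sum 0 r\<close> into
  \<open>pair_sum 1 r\<close>.\<close>

lemma profile_split:
  fixes m :: "nat \<Rightarrow> nat" and y :: "nat \<Rightarrow> real" and i j k r :: nat
  assumes ij: "i < k" "j < k" "i \<noteq> j" and r: "0 < r"
  defines "R \<equiv> \<Prod>l\<in>{..<k} - {i, j}. [:1, y l:] ^ m l"
  shows "profile r k m y = (\<Sum>t<r. pair_sum 0 t (m i) (y i) (m j) (y j) * coeff R (r - t))
    + pair_sum 1 r (m i) (y i) (m j) (y j) - (\<Sum>l\<in>{..<k} - {i, j}. real (m l choose r) * y l ^ r)"
proof -
  have R0: "coeff R 0 = 1" unfolding R_def coeff_0_prod by (simp add: coeff_const_power)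
  have "coeff (\<Prod>l<k. [:1, y l:] ^ m l) r = coeff (([:1, y i:] ^ m i * [:1, y j:] ^ m j) * R) r"
    unfolding prod_split_pair[OF ij] R_def by (simp only: mult.assoc)
  also have "\<dots> = (\<Sum>t\<le>r. pair_sum 0 t (m i) (y i) (m j) (y j) * coeff R (r - t))"
    unfolding coeff_mult[of _ R] pair_sum_coeff ..
  also have "{..r} = insert r {..<r}" by auto
  finally have "coeff (\<Prod>l<k. [:1, y l:] ^ m l) r
    = pair_sum 0 r (m i) (y i) (m j) (y j) + (\<Sum>t<r. pair_sum 0 t (m i) (y i) (m j) (y j) * coeff R (r - t))"
    by (simp add: R0)
  then show ?thesis
    unfolding profile_def sum_split_pair[OF ij] pair_sum_1[OF r] by simp
qed

text \<open>The optimal weights of the old graph, with the two affected ones replaced by those of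
  \<open>pair_transfer\<close>, give a strictly larger form at no greater norm. The terms
  \<open>t < r\<close> of \<open>profile_split\<close> do not decrease, since the coefficients of
  the other classes are nonnegative.\<close>

lemma Q_transfer_less:
  assumes p: "(p :: real) \<ge> 1" and r: "3 \<le> r"
    and ij: "i < k" "j < k" and m: "m i = Suc a" "m j = b" "b < a" "r \<le> Suc a"
  shows "p_spectral_radius r p (Q r k m) < p_spectral_radius r p (Q r k (m(i := a, j := Suc b)))"
proof -
  have "i \<noteq> j" using m by auto
  note ij = ij this
  let ?m = "m(i := a, j := Suc b)"
  have "(i, 0) \<in> (\<Union>l<k. Q_class m l)" using ij m by (auto simp: Q_class_def)
  then obtain y where y: "\<And>l. l < k \<Longrightarrow> 0 < y l" "(\<Sum>l<k. real (m l) * y l powr p) = 1"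
    "p_spectral_radius r p (Q r k m) = fact r * profile r k m y"
    using radius_complete_profile[OF class_partition_Q[of k m] p r]
    unfolding Q_eq card_Q_class by blast
  obtain x' y' where t: "0 < x'" "0 < y'"
    "\<And>t. pair_sum 0 t (Suc a) (y i) b (y j) \<le> pair_sum 0 t a x' (Suc b) y'"
    "pair_sum 1 r (Suc a) (y i) b (y j) < pair_sum 1 r a x' (Suc b) y'"
    "real a * x' powr p + real (Suc b) * y' powr p \<le> real (Suc a) * y i powr p + real b * y j powr p"
    using pair_transfer[OF p y(1)[OF ij(1)] y(1)[OF ij(2)] m(3) r m(4)] by blast
  define z where "z = y(i := x', j := y')"
  have zi: "z i = x'" and zj: "z j = y'" and z: "\<And>l. l \<noteq> i \<Longrightarrow> l \<noteq> j \<Longrightarrow> z l = y l"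
    using ij by (auto simp: z_def)
  have zpos: "0 < z l" if "l < k" for l using y(1)[OF that] t by (simp add: z_def)
  have mi: "?m i = a" and mj: "?m j = Suc b" and ml: "\<And>l. l \<noteq> i \<Longrightarrow> l \<noteq> j \<Longrightarrow> ?m l = m l"
    using ij by auto
  let ?R = "\<Prod>l\<in>{..<k} - {i, j}. [:1, y l:] ^ m l"
  have r0: "0 < r" using r by simp
  have R: "(\<Prod>l\<in>{..<k} - {i, j}. [:1, z l:] ^ ?m l) = ?R"
    by (rule prod.cong) (auto simp: z ml)
  have rest: "(\<Sum>l\<in>{..<k} - {i, j}. real (?m l choose r) * z l ^ r)
    = (\<Sum>l\<in>{..<k} - {i, j}. real (m l choose r) * y l ^ r)"
    by (rule sum.cong) (auto simp: z ml)
  have "(\<Sum>t<r. pair_sum 0 t (Suc a) (y i) b (y j) * coeff ?R (r - t))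
    \<le> (\<Sum>t<r. pair_sum 0 t a x' (Suc b) y' * coeff ?R (r - t))"
    using y(1) less_imp_le by (intro sum_mono mult_right_mono t(3) coeff_prod_nonneg)
      (auto simp: coeff_const_power intro!: mult_nonneg_nonneg zero_le_power)
  then have less: "profile r k m y < profile r k ?m z"
    unfolding profile_split[OF ij r0] R rest mi mj m(1,2) zi zj using t(4) by linarith
  have xz: "(\<lambda>v. z (fst v)) v = z l" if "v \<in> Q_class ?m l" for v l
    using that by (auto simp: Q_class_def)
  have Qz: "poly_form r (Q r k ?m) (\<lambda>v. z (fst v)) = fact r * profile r k ?m z"
    using poly_form_profile[OF class_partition_Q[of k ?m] r0 xz] by (simp only: Q_eq card_Q_class)
  have "(\<Sum>l<k. real (?m l) * z l powr p) \<le> (\<Sum>l<k. real (m l) * y l powr p)"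
  proof -
    have "(\<Sum>l\<in>{..<k} - {i, j}. real (?m l) * z l powr p) = (\<Sum>l\<in>{..<k} - {i, j}. real (m l) * y l powr p)"
      by (rule sum.cong) (auto simp: z ml)
    then show ?thesis
      unfolding sum_split_pair[OF ij] mi mj m(1,2) zi zj using t(5) by linarith
  qed
  moreover have "(\<Sum>l<k. real (?m l) * \<bar>z l\<bar> powr p) = (\<Sum>l<k. real (?m l) * z l powr p)"
    using zpos by (intro sum.cong refl) (simp add: abs_of_pos)
  ultimately have norm: "(\<Sum>v\<in>verts (Q r k ?m). \<bar>z (fst v)\<bar> powr p) \<le> 1"
    using norm_profile[where p = p, OF class_partition_Q[of k ?m], of "\<lambda>v. z (fst v)" z, OF xz] y(2)
    unfolding Q_eq verts_complete card_Q_class by linarith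
  have G: "r_graph r (Q r k ?m)" unfolding Q_eq by (rule r_graph_complete[OF class_partition_Q])
  have "(j, 0) \<in> verts (Q r k ?m)" using ij by (auto simp: Q_eq verts_complete Q_class_def)
  then have V: "verts (Q r k ?m) \<noteq> {}" by blast
  have Qm: "r_graph r (Q r k m)" unfolding Q_eq by (rule r_graph_complete[OF class_partition_Q])
  have "(i, 0) \<in> verts (Q r k m)" using ij m by (auto simp: Q_eq verts_complete Q_class_def)
  then have Vm: "verts (Q r k m) \<noteq> {}" by blast
  have l: "p_spectral_radius r p (Q r k m) < poly_form r (Q r k ?m) (\<lambda>v. z (fst v))"
    using less by (simp add: y(3) Qz)
  also have "\<dots> \<le> p_spectral_radius r p (Q r k ?m)"
    using l radius_nonneg[OF Qm Vm p] by (intro radius_ge[OF G V p r0 norm]) simp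
  finally show ?thesis .
qed

section \<open>Isomorphism invariance and balanced class sizes\<close>

lemma isomorphic_radius:
  assumes G: "r_graph r G" and iso: "isomorphic G H"
  shows "p_spectral_radius r p G = p_spectral_radius r p H"
proof -
  obtain f where f: "bij_betw f (verts G) (verts H)" "edges H = (\<lambda>e. f ` e) ` edges G"
    using iso by (auto simp: isomorphic_def)
  have inj: "inj_on f (verts G)" using f by (simp add: bij_betw_def)
  have sub: "edges G \<subseteq> Pow (verts G)" using G by (auto simp: r_graph_def)
  have form: "poly_form r H y = poly_form r G (\<lambda>v. y (f v))" for y
  proof -
    have "(\<Sum>e\<in>edges H. prod y e) = (\<Sum>e\<in>edges G. prod y (f ` e))"
      unfolding f(2) using inj_on_subset[OF inj_on_image_Pow[OF inj] sub]
      by (subst sum.reindex) auto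
    also have "\<dots> = (\<Sum>e\<in>edges G. \<Prod>v\<in>e. y (f v))"
      using inj sub by (intro sum.cong refl) (subst prod.reindex, auto intro: inj_on_subset)
    finally show ?thesis by (simp add: poly_form_def)
  qed
  have norm: "(\<Sum>v\<in>verts H. \<bar>y v\<bar> powr p) = (\<Sum>v\<in>verts G. \<bar>y (f v)\<bar> powr p)" for y
    using sum.reindex_bij_betw[OF f(1), of "\<lambda>v. \<bar>y v\<bar> powr p"] by simp
  \<comment> \<open>Equal sets of values give equal radii without any appeal to the existence of a
    maximum.\<close>
  have "{poly_form r G x | x. (\<Sum>v\<in>verts G. \<bar>x v\<bar> powr p) = 1}
    = {poly_form r H y | y. (\<Sum>v\<in>verts H. \<bar>y v\<bar> powr p) = 1}" (is "?A = ?B")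
  proof (intro equalityI subsetI)
    fix c assume "c \<in> ?A"
    then obtain x where x: "c = poly_form r G x" "(\<Sum>v\<in>verts G. \<bar>x v\<bar> powr p) = 1" by blast
    define y where "y = x \<circ> inv_into (verts G) f"
    have yf: "y (f v) = x v" if "v \<in> verts G" for v
      using that inj by (simp add: y_def)
    have "(\<Sum>v\<in>verts H. \<bar>y v\<bar> powr p) = 1" using x(2) yf by (simp add: norm)
    moreover have "(\<Prod>v\<in>e. y (f v)) = prod x e" if "e \<in> edges G" for e
      using that sub yf by (intro prod.cong) auto
    then have "poly_form r H y = c"
      unfolding form x(1) unfolding poly_form_def by simp
    ultimately show "c \<in> ?B" by blast
  next
    fix c assume "c \<in> ?B"
    then obtain y where "c = poly_form r H y" "(\<Sum>v\<in>verts H. \<bar>y v\<bar> powr p) = 1" by blast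
    then show "c \<in> ?A" unfolding form norm by (auto intro!: exI[of _ "\<lambda>v. y (f v)"])
  qed
  then show ?thesis by (simp add: p_spectral_radius_def)
qed

text \<open>Bijections between matching classes glue to a bijection of the vertex sets; it respects
  edges because it maps each class onto a class.\<close>

lemma isomorphic_complete:
  fixes W :: "nat \<Rightarrow> 'a set" and W' :: "nat \<Rightarrow> 'b set"
  assumes W: "class_partition k W" "class_partition k W'"
    and s: "bij_betw s {..<k} {..<k}" "\<And>i. i < k \<Longrightarrow> card (W i) = card (W' (s i))"
  shows "isomorphic (complete_chromatic r k W) (complete_chromatic r k W')"
proof -
  have sk: "s i < k" if "i < k" for i using s(1) that by (auto simp: bij_betw_def)
  have fin: "finite (W i)" "finite (W' i)" if "i < k" for i
    using W that by (auto simp: class_partition_def)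
  have "\<exists>h. bij_betw h (W i) (W' (s i))" if "i < k" for i
    using that s(2) sk fin by (intro finite_same_card_bij) auto
  then obtain h where h: "\<And>i. i < k \<Longrightarrow> bij_betw (h i) (W i) (W' (s i))" by metis
  define c where "c v = (SOME i. i < k \<and> v \<in> W i)" for v
  have c: "c v = i" if "i < k" "v \<in> W i" for i v
    using someI[of "\<lambda>i. i < k \<and> v \<in> W i" i] that class_eq[OF W(1), of i "c v" v]
    by (auto simp: c_def)
  define f where "f v = h (c v) v" for v
  have fW: "bij_betw f (W i) (W' (s i))" if "i < k" for i
    using h[OF that] by (rule bij_betw_cong[THEN iffD1, rotated]) (simp add: f_def c[OF that])
  let ?V = "\<Union>i<k. W i" and ?V' = "\<Union>i<k. W' i"
  have dis: "disjoint_family_on (\<lambda>i. W' (s i)) {..<k}"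
    unfolding disjoint_family_on_def
  proof (intro ballI impI)
    fix i l assume "i \<in> {..<k}" "l \<in> {..<k}" "i \<noteq> l"
    moreover from this have "s i \<noteq> s l" using s(1) by (auto simp: bij_betw_def inj_on_def)
    ultimately show "W' (s i) \<inter> W' (s l) = {}"
      using W(2) sk by (auto simp: class_partition_def disjoint_family_on_def)
  qed
  have "(\<Union>i<k. W' (s i)) = ?V'"
    using s(1) by (metis bij_betw_imp_surj_on image_image)
  then have fV: "bij_betw f ?V ?V'"
    using bij_betw_UNION_disjoint[OF dis fW] by simp
  then have inj: "inj_on f ?V" by (simp add: bij_betw_def)
  have sub: "f ` e \<subseteq> W' (s i) \<longleftrightarrow> e \<subseteq> W i" if "e \<subseteq> ?V" "i < k" for e i
  proof -
    have "W' (s i) = f ` W i" using fW[OF that(2)] by (simp add: bij_betw_def)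
    then show ?thesis using inj_on_image_subset_iff[OF inj that(1), of "W i"] that(2) by auto
  qed
  have "edges (complete_chromatic r k W') = (\<lambda>e. f ` e) ` edges (complete_chromatic r k W)"
  proof (intro equalityI subsetI)
    fix e' assume e': "e' \<in> edges (complete_chromatic r k W')"
    then have "e' \<subseteq> f ` ?V" using fV by (auto simp: edges_complete bij_betw_def)
    then obtain e where e: "e \<subseteq> ?V" "e' = f ` e" by (auto simp: subset_image_iff)
    have "card e = r" using e e' card_image[OF inj_on_subset[OF inj e(1)]] by (simp add: edges_complete)
    moreover have "\<not> e \<subseteq> W i" if "i < k" for i
      using sub[OF e(1) that] e' e(2) sk[OF that] by (auto simp: edges_complete)
    ultimately show "e' \<in> (\<lambda>e. f ` e) ` edges (complete_chromatic r k W)"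
      using e by (auto simp: edges_complete)
  next
    fix e' assume "e' \<in> (\<lambda>e. f ` e) ` edges (complete_chromatic r k W)"
    then obtain e where e: "e' = f ` e" "e \<subseteq> ?V" "card e = r" "\<And>i. i < k \<Longrightarrow> \<not> e \<subseteq> W i"
      by (auto simp: edges_complete)
    have "e' \<subseteq> ?V'" using image_mono[OF e(2), of f] e(1) fV by (simp add: bij_betw_def)
    moreover have "card e' = r" using e card_image[OF inj_on_subset[OF inj e(2)]] by simp
    moreover have "\<not> e' \<subseteq> W' l" if "l < k" for l
    proof -
      have "l \<in> s ` {..<k}" using s(1) that by (simp add: bij_betw_def)
      then obtain i where i: "i < k" "l = s i" by auto
      then show ?thesis using sub[OF e(2) i(1)] e(1,4) by simp
    qed
    ultimately show "e' \<in> edges (complete_chromatic r k W')" by (simp add: edges_complete)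
  qed
  with fV show ?thesis unfolding isomorphic_def verts_complete by blast
qed

text \<open>With \<open>q\<close> the least size, \<open>n = k * q + c\<close>, where
  \<open>c\<close> counts the classes of size \<open>q + 1\<close>. The class attaining the minimum
  gives \<open>c < k\<close>, so this is division with remainder.\<close>

lemma balanced_sizes_values:
  assumes "balanced_sizes k n m" "0 < k"
  shows "\<And>i. i < k \<Longrightarrow> m i = n div k \<or> m i = Suc (n div k)"
    and "card {i \<in> {..<k}. m i = Suc (n div k)} = n mod k"
proof -
  have "m ` {..<k} \<noteq> {}" using assms(2) by auto
  then have "Min (m ` {..<k}) \<in> m ` {..<k}" by (intro Min_in) auto
  then obtain j where j: "j < k" "m j = Min (m ` {..<k})" by auto
  define q where "q = m j"
  have q: "m i = q \<or> m i = Suc q" if "i < k" for i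
  proof -
    have "q \<le> m i" using that by (simp add: q_def j(2))
    moreover have "m i \<le> q + 1" using assms(1) that j(1) by (simp add: balanced_sizes_def q_def)
    ultimately show ?thesis by linarith
  qed
  let ?C = "{i \<in> {..<k}. m i = Suc q}"
  have "n = (\<Sum>i<k. m i)" using assms(1) by (simp add: balanced_sizes_def)
  also have "\<dots> = (\<Sum>i<k. q + (if m i = Suc q then 1 else 0))"
    using q by (intro sum.cong refl) force
  also have "\<dots> = k * q + card ?C"
    by (simp add: sum.distrib sum.If_cases Int_def)
  finally have n: "n = k * q + card ?C" .
  have "j \<notin> ?C" "j \<in> {..<k}" using j(1) by (simp_all add: q_def)
  then have "?C \<subset> {..<k}" by blast
  then have "card ?C < k" using psubset_card_mono[of "{..<k}" ?C] by simp
  then have "n div k = q" "n mod k = card ?C" using n by simp_all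
  then show "\<And>i. i < k \<Longrightarrow> m i = n div k \<or> m i = Suc (n div k)"
    and "card {i \<in> {..<k}. m i = Suc (n div k)} = n mod k"
    using q by simp_all
qed

lemma balanced_sizes_permutation:
  assumes m: "balanced_sizes k n m" "balanced_sizes k n m'" and k: "0 < k"
  obtains s where "bij_betw s {..<k} {..<k}" "\<And>i. i < k \<Longrightarrow> m i = m' (s i)"
proof -
  define A where "A = {i \<in> {..<k}. m i = Suc (n div k)}"
  define A' where "A' = {i \<in> {..<k}. m' i = Suc (n div k)}"
  have card: "card A = card A'"
    unfolding A_def A'_def using balanced_sizes_values(2)[OF m(1) k] balanced_sizes_values(2)[OF m(2) k] by simp
  have fin: "finite A" "finite A'" and sub: "A \<subseteq> {..<k}" "A' \<subseteq> {..<k}"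
    by (auto simp: A_def A'_def)
  obtain f where f: "bij_betw f A A'" using finite_same_card_bij[OF fin card] by blast
  have "card ({..<k} - A) = card ({..<k} - A')"
    using card fin sub by (simp add: card_Diff_subset)
  then obtain g where g: "bij_betw g ({..<k} - A) ({..<k} - A')"
    using finite_same_card_bij[of "{..<k} - A" "{..<k} - A'"] by auto
  define s where "s i = (if i \<in> A then f i else g i)" for i
  have "bij_betw s (A \<union> ({..<k} - A)) (A' \<union> ({..<k} - A'))"
    unfolding s_def by (rule bij_betw_disjoint_Un[OF f g]) auto
  then have s: "bij_betw s {..<k} {..<k}" using sub by (simp add: Un_absorb1)
  show ?thesis
  proof (rule that[OF s])
    fix i assume i: "i < k"
    show "m i = m' (s i)"
    proof (cases "i \<in> A")
      case True
      then have "f i \<in> A'" using f by (auto simp: bij_betw_def)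
      with True show ?thesis by (simp add: s_def A_def A'_def)
    next
      case False
      then have "g i \<in> {..<k} - A'" using g i by (auto simp: bij_betw_def)
      with False i show ?thesis
        using balanced_sizes_values(1)[OF m(1) k i] balanced_sizes_values(1)[OF m(2) k, of "g i"]
        by (auto simp: s_def A_def A'_def)
    qed
  qed
qed

lemma isomorphic_Q_balanced:
  assumes "class_partition k W" "balanced_sizes k n (\<lambda>i. card (W i))" "balanced_sizes k n ns" "0 < k"
  shows "isomorphic (complete_chromatic r k W) (Q r k ns)"
proof -
  obtain s where "bij_betw s {..<k} {..<k}" "\<And>i. i < k \<Longrightarrow> card (W i) = ns (s i)"
    using balanced_sizes_permutation[OF assms(2-4)] by blast
  then show ?thesis
    unfolding Q_eq using assms(1) by (intro isomorphic_complete class_partition_Q) (simp_all add: card_Q_class)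
qed

text \<open>Induction on the sum of squared sizes, which drops when a vertex moves to a class
  smaller by at least two. Each move made here strictly increases the radius by
  \<open>Q_transfer_less\<close>, so unbalanced sizes never reach equality.\<close>

lemma radius_Q_le_balanced:
  assumes p: "(p :: real) \<ge> 1" and r: "3 \<le> r" and k: "0 < k" and n: "n > (r - 1) * k"
    and m: "(\<Sum>i<k. m i) = n" and ns: "balanced_sizes k n ns"
  shows "p_spectral_radius r p (Q r k m) \<le> p_spectral_radius r p (Q r k ns) \<and>
    (p_spectral_radius r p (Q r k m) = p_spectral_radius r p (Q r k ns) \<longrightarrow> balanced_sizes k n m)"
  using m
proof (induction "\<Sum>i<k. (m i)\<^sup>2" arbitrary: m rule: less_induct)
  case less
  show ?case
  proof (cases "balanced_sizes k n m")
    case True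
    then have "isomorphic (Q r k m) (Q r k ns)"
      unfolding Q_eq[of r k m] using ns k
      by (intro isomorphic_Q_balanced class_partition_Q) (simp_all add: card_Q_class)
    moreover have "r_graph r (Q r k m)" unfolding Q_eq by (rule r_graph_complete[OF class_partition_Q])
    ultimately show ?thesis using True by (simp add: isomorphic_radius)
  next
    case False
    then obtain i0 j where j: "i0 < k" "j < k" "m i0 > m j + 1"
      using less.prems by (auto simp: balanced_sizes_def not_le)
    \<comment> \<open>The largest class is the donor: \<open>n > (r - 1) * k\<close> forces it to
      have at least \<open>r\<close> vertices, which the class \<open>i0\<close> need not
      have.\<close>
    have "m ` {..<k} \<noteq> {}" using k by auto
    then have "Max (m ` {..<k}) \<in> m ` {..<k}" by (intro Max_in) auto
    then obtain i where i: "i < k" "m i = Max (m ` {..<k})" by auto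
    have max: "m l \<le> m i" if "l < k" for l using that by (simp add: i(2))
    have "r \<le> m i"
    proof (rule ccontr)
      assume "\<not> r \<le> m i"
      then have "(\<Sum>l<k. m l) \<le> (\<Sum>l<k. r - 1)" using max by (intro sum_mono) fastforce
      then show False using less.prems n by (simp add: mult.commute)
    qed
    define a where "a = m i - 1"
    define b where "b = m j"
    have a: "m i = Suc a" "b < a" "r \<le> Suc a"
      using max[OF j(1)] j(3) \<open>r \<le> m i\<close> r by (auto simp: a_def b_def)
    have ij: "i < k" "j < k" "i \<noteq> j" using i j a by (auto simp: b_def)
    let ?m = "m(i := a, j := Suc b)"
    have rest: "(\<Sum>l\<in>{..<k} - {i, j}. f (?m l)) = (\<Sum>l\<in>{..<k} - {i, j}. f (m l))" for f :: "nat \<Rightarrow> nat"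
      by (rule sum.cong) auto
    have "(\<Sum>l<k. ?m l) = n"
      using less.prems rest[of "\<lambda>x. x"] ij a unfolding sum_split_pair[OF ij] by (simp add: b_def)
    moreover have "(\<Sum>l<k. (?m l)\<^sup>2) < (\<Sum>l<k. (m l)\<^sup>2)"
      using rest[of "\<lambda>x. x\<^sup>2"] ij a unfolding sum_split_pair[OF ij]
      by (simp add: b_def power2_eq_square)
    ultimately have "p_spectral_radius r p (Q r k ?m) \<le> p_spectral_radius r p (Q r k ns)"
      using less.hyps by blast
    moreover have "p_spectral_radius r p (Q r k m) < p_spectral_radius r p (Q r k ?m)"
      using Q_transfer_less[where m = m, OF p r ij(1,2) a(1) _ a(2,3)] by (simp add: b_def)
    ultimately show ?thesis by simp
  qed
qed

section \<open>Arbitrary chromatic graphs and the case of equality\<close>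

theorem theorem1p3:
  fixes r k n :: nat and p :: real
    and G :: "'a hypergraph" and ns :: "nat \<Rightarrow> nat"
  assumes "r \<ge> 4" and "k \<ge> 2" and "p \<ge> 1" and "n > (r - 1) * k"
    and "r_graph r G" and "card (verts G) = n" and "k_chromatic k G"
    and "balanced_sizes k n ns"
  shows "p_spectral_radius r p G \<le> p_spectral_radius r p (Q r k ns) \<and>
    (p_spectral_radius r p G = p_spectral_radius r p (Q r k ns) \<longleftrightarrow> isomorphic G (Q r k ns))"
proof -
  obtain W :: "nat \<Rightarrow> 'a set" where W: "(\<Union>i<k. W i) = verts G" "disjoint_family_on W {..<k}"
    "\<And>e i. e \<in> edges G \<Longrightarrow> i < k \<Longrightarrow> \<not> e \<subseteq> W i"
    using assms(7) by (auto simp: k_chromatic_def)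
  have fV: "finite (verts G)" using assms(5) by (simp add: r_graph_def)
  have part: "class_partition k W"
    unfolding class_partition_def using W(1,2) fV by (auto intro: finite_subset)
  let ?H = "complete_chromatic r k W" and ?m = "\<lambda>i. card (W i)"
  have r: "3 \<le> r" "0 < r" and k: "0 < k" using assms(1,2) by auto
  have "0 < n" using assms(4) by simp
  then have V: "verts G \<noteq> {}" using assms(6) by auto
  have VH: "verts ?H = verts G" using W(1) by (simp add: verts_complete)
  have H: "r_graph r ?H" by (rule r_graph_complete[OF part])
  have sub: "edges G \<subseteq> edges ?H"
    using assms(5) W(1,3) by (auto simp: edges_complete r_graph_def)
  have "(\<Sum>i<k. card (W i)) = card (\<Union>i<k. W i)"
    using part by (intro card_UN_disjoint[symmetric]) (auto simp: class_partition_def disjoint_family_on_def)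
  then have sum: "(\<Sum>i<k. card (W i)) = n" using W(1) assms(6) by simp
  have "isomorphic ?H (Q r k ?m)"
    unfolding Q_eq by (rule isomorphic_complete[OF part class_partition_Q, of id]) (auto simp: card_Q_class)
  then have HQ: "p_spectral_radius r p ?H = p_spectral_radius r p (Q r k ?m)"
    by (rule isomorphic_radius[OF H])
  note bal = radius_Q_le_balanced[OF assms(3) r(1) k assms(4) sum assms(8), folded HQ]
  \<comment> \<open>An optimal vector of \<open>G\<close> is tested on \<open>?H\<close>; the two
    forms differ by the products over the missing edges.\<close>
  obtain x where x: "\<And>v. 0 \<le> x v" "(\<Sum>v\<in>verts G. x v powr p) = 1"
    "poly_form r G x = p_spectral_radius r p G"
    using radius_attained_nonneg[OF assms(5) V assms(3)] by blast
  have prod0: "0 \<le> prod x e" for e using x(1) by (intro prod_nonneg) auto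
  have split: "poly_form r ?H x = poly_form r G x + fact r * (\<Sum>e\<in>edges ?H - edges G. prod x e)"
    unfolding poly_form_def using sum.subset_diff[OF sub finite_edges[OF H], of "prod x"]
    by (simp add: distrib_left)
  have xH: "poly_form r ?H x \<le> p_spectral_radius r p ?H"
    using x VH V by (intro p_spectral_radius_attained(2)[OF H _ assms(3)]) simp_all
  have missing: "0 \<le> fact r * (\<Sum>e\<in>edges ?H - edges G. prod x e)"
    using prod0 by (intro mult_nonneg_nonneg sum_nonneg) auto
  have GH: "p_spectral_radius r p G \<le> p_spectral_radius r p ?H" using missing split xH x(3) by linarith
  have uniq: "isomorphic G (Q r k ns)" if eq: "p_spectral_radius r p G = p_spectral_radius r p (Q r k ns)"
  proof -
    \<comment> \<open>Equality makes the whole chain from \<open>G\<close> over \<open>?H\<close> to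
      the balanced graph tight, so \<open>x\<close> is optimal for \<open>?H\<close> as
      well.\<close>
    have eqH: "p_spectral_radius r p ?H = p_spectral_radius r p G" using eq GH bal by linarith
    have m: "balanced_sizes k n ?m" using bal eq eqH by simp
    have opt: "poly_form r ?H x = p_spectral_radius r p ?H" 
      using missing xH split x(3) eqH by linarith
    have "edges ?H \<noteq> {}"
    proof -
      \<comment> \<open>An empty class would limit all balanced sizes to 1, hence
        \<open>n <= k\<close>, contrary to \<open>n > (r - 1) * k\<close>.\<close>
      have "W i \<noteq> {}" if "i < k" for i
      proof
        assume "W i = {}"
        then have "card (W l) \<le> 1" if "l < k" for l
          using m \<open>i < k\<close> that by (force simp: balanced_sizes_def)
        then have "(\<Sum>l<k. card (W l)) \<le> (\<Sum>l<k. 1)" by (intro sum_mono) auto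
        moreover have "1 * k \<le> (r - 1) * k" using r by (intro mult_right_mono) auto
        ultimately show False using sum assms(4) by simp
      qed
      then obtain u w where uw: "u \<in> W 0" "w \<in> W 1" using assms(2) k by fastforce
      have k1: "(0::nat) < k" "1 < k" using assms(2) by auto
      have "u \<noteq> w" using class_eq[OF part k1, of u] uw by auto
      have "(r - 1) * 2 \<le> (r - 1) * k" using assms(2) by (intro mult_left_mono) auto
      moreover have "r \<le> (r - 1) * 2" using r by simp
      ultimately have "r \<le> card (verts G)" using assms(4,6) by linarith
      moreover have "{u, w} \<subseteq> verts G" using uw k1 W(1) by blast
      ultimately obtain e where e: "{u, w} \<subseteq> e" "e \<subseteq> verts G" "card e = r"
        using exists_subset_between[of "{u, w}" r "verts G"] fV r \<open>u \<noteq> w\<close> by auto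
      have "w \<notin> W 0" using class_eq[OF part k1, of w] uw by auto
      then have "e \<in> edges ?H"
        using e uw W(1) by (intro edge_completeI[OF part _ _ k1(1), of _ _ u w]) auto
      then show ?thesis by blast
    qed
    then have posH: "0 < p_spectral_radius r p ?H" by (rule radius_pos[OF H assms(3) r(2)])
    have pos: "0 < x v" if v: "v \<in> verts G" for v
    proof -
      obtain i where "i < k" "v \<in> W i" using v unfolding W(1)[symmetric] by auto
      then show ?thesis
        using optimal_complete(2)[OF part assms(3) r(1) x(1) x(2)[folded W(1)] opt posH] by blast
    qed
    \<comment> \<open>As all weights are positive, a missing edge would make the form of
      \<open>?H\<close> at \<open>x\<close> exceed that of \<open>G\<close>.\<close>
    have "edges ?H \<subseteq> edges G"
    proof (rule ccontr)
      assume "\<not> edges ?H \<subseteq> edges G"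
      then obtain e where e: "e \<in> edges ?H - edges G" by blast
      have "0 < prod x e" using e pos W(1) by (intro prod_pos) (auto simp: edges_complete)
      also have "\<dots> \<le> (\<Sum>e\<in>edges ?H - edges G. prod x e)"
        using e prod0 finite_edges[OF H] by (intro member_le_sum) auto
      finally show False using split opt x(3) eqH by simp
    qed
    then have "G = ?H" using sub VH by (intro prod_eqI) auto
    then show ?thesis using isomorphic_Q_balanced[OF part m assms(8) k] by simp
  qed
  show ?thesis
  proof (intro conjI iffI)
    show "p_spectral_radius r p G \<le> p_spectral_radius r p (Q r k ns)" using GH bal by linarith
  qed (fact uniq isomorphic_radius[OF assms(5)])+
qed

end
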